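(* Let $d\ge1$ be an integer, let $V=(V_j(t))_{j\in\mathbb{Z}^d,\,t\in[0,1]}$ be a time-dependent bounded potential, and let $u=(u_j)_{j\in\mathbb{Z}^d}$ be a solution on $[0,1]$ of $$\partial_t u_j=i(\Delta_d u_j+V_ju_j),\qquad \Delta_d u_j=\sum_{k=1}^d(u_{j+e_k}-2u_j+u_{j-e_k}),\qquad j\in\mathbb{Z}^d.$$ Assume that for some $\lambda>1/2$ $$\sum_{j\in\mathbb{Z}^d}e^{2\lambda|j|^2}|u_j(0)|^2+\sum_{j\in\mathbb{Z}^d}e^{2\lambda|j|^2}|u_j(1)|^2<+\infty.$$ Then $u\equiv0$.
   Context: $e_1,\dots,e_d$ is the standard basis of $\mathbb{Z}^d$ and $|j|$ is the Euclidean norm of $j$. A time-dependent bounded potential is a family of complex-valued measurable functions $V_j:[0,1]\to\mathbb{C}$ with $\|V\|_\infty=\sup_{j\in\mathbb{Z}^d,\,t\in[0,1]}|V_j(t)|<\infty$. A solution on $[0,1]$ means a complex-valued $u\in C([0,1];\ell^2(\mathbb{Z}^d))$ whose components are absolutely continuous in $t$ and satisfy the equation for almost every $t$. *)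

theory Defs
  imports "HOL-Analysis.Analysis"
begin

(* The lattice Z^d is the type int ^ 'd, with d = CARD('d) >= 1 and e_k = axis k 1.
   Families over [0,1] x Z^d are functions u :: real => int ^ 'd => complex, written u t j
   for u_j(t); only the values at t in {0..1} are ever constrained. *)

definition lattice_norm :: "int ^ 'd::finite \<Rightarrow> real" where
  "lattice_norm j = norm (\<chi> k. real_of_int (j $ k))"

definition discrete_laplacian :: "(int ^ 'd::finite \<Rightarrow> complex) \<Rightarrow> int ^ 'd \<Rightarrow> complex" where
  "discrete_laplacian f j = (\<Sum>k\<in>UNIV. f (j + axis k 1) - 2 * f j + f (j - axis k 1))"

definition ell2 :: "('a \<Rightarrow> complex) set" where
  "ell2 = {f. (\<lambda>j. (cmod (f j))\<^sup>2) summable_on UNIV}"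

(* Meaningful on ell2 only: infsum returns 0 for a family that is not summable. *)
definition ell2_norm :: "('a \<Rightarrow> complex) \<Rightarrow> real" where
  "ell2_norm f = sqrt (\<Sum>\<^sub>\<infinity>j. (cmod (f j))\<^sup>2)"

definition ell2_continuous_on :: "real set \<Rightarrow> (real \<Rightarrow> 'a \<Rightarrow> complex) \<Rightarrow> bool" where
  "ell2_continuous_on S u \<longleftrightarrow>
     (\<forall>t\<in>S. u t \<in> ell2) \<and>
     (\<forall>t\<in>S. ((\<lambda>s. ell2_norm (\<lambda>j. u s j - u t j)) \<longlongrightarrow> 0) (at t within S))"

(* Absolute continuity of a function on an interval S; the library's absolutely_continuous
   is the relation between measures. *)
definition absolutely_continuous_on :: "real set \<Rightarrow> (real \<Rightarrow> 'a::real_normed_vector) \<Rightarrow> bool" where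
  "absolutely_continuous_on S f \<longleftrightarrow>
     (\<forall>\<epsilon>>0. \<exists>\<delta>>0. \<forall>(n::nat) a b.
        (\<forall>i<n. a i \<le> b i \<and> {a i..b i} \<subseteq> S) \<longrightarrow>
        disjoint_family_on (\<lambda>i. {a i<..<b i}) {..<n} \<longrightarrow>
        (\<Sum>i<n. b i - a i) < \<delta> \<longrightarrow>
        (\<Sum>i<n. norm (f (b i) - f (a i))) < \<epsilon>)"

definition bounded_potential :: "(real \<Rightarrow> int ^ 'd::finite \<Rightarrow> complex) \<Rightarrow> bool" where
  "bounded_potential V \<longleftrightarrow>
     (\<forall>j. (\<lambda>t. V t j) \<in> borel_measurable (lebesgue_on {0..1})) \<and>
     bdd_above ((\<lambda>(t, j). cmod (V t j)) ` ({0..1} \<times> UNIV))"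

definition schroedinger_solution ::
    "(real \<Rightarrow> int ^ 'd::finite \<Rightarrow> complex) \<Rightarrow> (real \<Rightarrow> int ^ 'd \<Rightarrow> complex) \<Rightarrow> bool" where
  "schroedinger_solution V u \<longleftrightarrow>
     ell2_continuous_on {0..1} u \<and>
     (\<forall>j. absolutely_continuous_on {0..1} (\<lambda>t. u t j)) \<and>
     (\<forall>j. AE t in lebesgue_on {0..1}.
        ((\<lambda>s. u s j) has_vector_derivative \<i> * (discrete_laplacian (u t) j + V t j * u t j))
          (at t within {0..1}))"

end

theory Submission
  imports Defs "HOL-Real_Asymp.Real_Asymp"
begin

text \<open>
  Let \<open>w\<close> be the weight \<open>w i = K ^ |i| (2 |i| - 1)!!\<close> in one coordinate \<open>i\<close> of the lattice and let
  \<open>F = \<Sum>j. (w (i + 1) - w i) Im (u (j + e) cnj (u j))\<close> be half the derivative of \<open>\<Sum>j. w i |u j|\<^sup>2\<close> for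
  \<open>V = 0\<close>.  Its derivative is \<open>2 |S f|\<^sup>2\<close> plus a commutator term plus the contribution of \<open>V\<close>, where
  \<open>f = sqrt w u\<close> and \<open>S\<close> is the symmetric part of the conjugated evolution.  Since \<open>w (i + 1) / w i\<close>
  grows linearly in \<open>|i|\<close> with slope \<open>2 K\<close>, the commutator is at least \<open>K / 2 - 1\<close>, uniformly on the
  lattice.  Hence \<open>F' \<ge> |S f|\<^sup>2 + \<kappa> |f|\<^sup>2 \<ge> 2 sqrt \<kappa> |F|\<close> with \<open>\<kappa> = K / 2 - 1 - M\<^sup>2\<close> and \<open>M\<close> a bound
  of \<open>V\<close>, so at interior times \<open>\<kappa> |f|\<^sup>2\<close> is, on average, at most \<open>exp (- c sqrt K)\<close> times the size of \<open>F\<close>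
  at the times 0 and 1.  Gaussian decay bounds the latter by \<open>exp (C (ln K)\<^sup>2)\<close>, and \<open>K \<longrightarrow> \<infinity>\<close> forces
  \<open>u = 0\<close>.  The sums converge because a datum that decays like a Gaussian stays superexponentially
  small, by comparison with the positive system that dominates the equation.
\<close>

section \<open>Absolutely continuous functions\<close>

text \<open>The potential is complex and merely measurable in time, so \<open>sum w |u|^2\<close>,
  whose derivative contains \<open>Im V\<close>, cannot be differentiated twice. The current
  \<open>F\<close> does not contain \<open>V\<close>, one derivative of it suffices, and a
  half-shift turns it into the pairing of \<open>S f\<close> with \<open>f\<close>; this is how
  convexity becomes a first-order inequality. The weight has to fit the decay available at interior
  times. Even the free evolution of a point mass decays no faster than \<open>t ^ n / n!\<close>, so
  a Gaussian weight could not be summed, whereas \<open>K ^ n (2 n - 1)!!\<close> is summable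
  against \<open>1 / (n!)^2\<close> times any geometric factor. It depends on one coordinate only,
  so the other directions of the Laplacian commute with it and merely telescope. Interior decay is
  used qualitatively, for convergence; the dependence of its constants on \<open>K\<close> is not
  tracked. The quantitative input is the size of \<open>F\<close> at the two endpoint times, where
  maximising \<open>n ln K - c n^2\<close> over \<open>n\<close> gives the order
  \<open>(ln K)^2\<close> in the exponent.\<close>

lemma absolutely_continuous_on_subset:
  assumes "absolutely_continuous_on S f" "T \<subseteq> S"
  shows "absolutely_continuous_on T f"
  using assms unfolding absolutely_continuous_on_def by (meson order_trans)

lemma absolutely_continuous_on_finite_family:
  assumes ac: "\<forall>(n::nat) a b. (\<forall>i<n. a i \<le> b i \<and> {a i..b i} \<subseteq> S) \<longrightarrow>
      disjoint_family_on (\<lambda>i. {a i<..<b i}) {..<n} \<longrightarrow>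
      (\<Sum>i<n. b i - a i) < \<delta> \<longrightarrow> (\<Sum>i<n. norm (f (b i) - f (a i))) < \<epsilon>"
    and "finite I" and ab: "\<And>i. i \<in> I \<Longrightarrow> l i \<le> r i \<and> {l i..r i} \<subseteq> S"
    and disj: "disjoint_family_on (\<lambda>i. {l i<..<r i}) I"
    and len: "(\<Sum>i\<in>I. r i - l i) < \<delta>"
  shows "(\<Sum>i\<in>I. norm (f (r i) - f (l i))) < \<epsilon>"
proof -
  obtain h where h: "bij_betw h {..<card I} I"
    using ex_bij_betw_nat_finite[OF \<open>finite I\<close>] by (auto simp: atLeast0LessThan)
  have hI: "h i \<in> I" if "i < card I" for i
    using h that by (auto simp: bij_betw_def)
  have dj: "disjoint_family_on (\<lambda>i. {l (h i)<..<r (h i)}) {..<card I}"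
    unfolding disjoint_family_on_def
  proof (intro ballI impI)
    fix m n assume mn: "m \<in> {..<card I}" "n \<in> {..<card I}" "m \<noteq> n"
    then have "h m \<noteq> h n" using h by (auto simp: bij_betw_def inj_on_def)
    with mn disj hI show "{l (h m)<..<r (h m)} \<inter> {l (h n)<..<r (h n)} = {}"
      unfolding disjoint_family_on_def by blast
  qed
  have "(\<Sum>i<card I. r (h i) - l (h i)) = (\<Sum>i\<in>I. r i - l i)"
    by (rule sum.reindex_bij_betw[OF h])
  then have "(\<Sum>i<card I. norm (f (r (h i)) - f (l (h i)))) < \<epsilon>"
    using ac[rule_format, of "card I" "\<lambda>i. l (h i)" "\<lambda>i. r (h i)"] dj len ab hI by simp
  also have "(\<Sum>i<card I. norm (f (r (h i)) - f (l (h i)))) = (\<Sum>i\<in>I. norm (f (r i) - f (l i)))"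
    by (rule sum.reindex_bij_betw[OF h])
  finally show ?thesis .
qed

text \<open>Tags in the exceptional null set get a gauge inside an open set of small measure, so that
  absolute continuity controls the corresponding increments; the other tags are treated as in the
  classical fundamental theorem.\<close>

theorem absolutely_continuous_on_FTC:
  fixes f :: "real \<Rightarrow> 'a::real_normed_vector"
  assumes "a \<le> b" and ac: "absolutely_continuous_on {a..b} f" and N: "negligible N"
    and der: "\<And>t. t \<in> {a..b} - N \<Longrightarrow> (f has_vector_derivative D t) (at t within {a..b})"
  shows "(D has_integral (f b - f a)) {a..b}"
proof (rule has_integral_spike[OF N])
  \<comment> \<open>With the value 0 on \<open>N\<close>, tags in \<open>N\<close> add nothing to
    the Riemann sum, and only the increments of \<open>f\<close> over their intervals remain to be
    estimated.\<close>
  define D' where "D' t = (if t \<in> N then 0 else D t)" for t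
  show "D t = D' t" if "t \<in> {a..b} - N" for t
    using that by (simp add: D'_def)
  show "(D' has_integral (f b - f a)) {a..b}"
    unfolding has_integral_real
  proof (intro allI impI)
    fix e :: real assume "e > 0"
    \<comment> \<open>The summand 1 keeps the quotient meaningful when \<open>a = b\<close>.\<close>
    define e' where "e' = e / (4 * (b - a + 1))"
    have e': "e' > 0" "e' * (b - a) \<le> e / 4"
      using \<open>e > 0\<close> \<open>a \<le> b\<close> by (auto simp: e'_def field_simps)
    have "e / 4 > 0" using \<open>e > 0\<close> by simp
    then obtain \<delta> where "\<delta> > 0" and \<delta>: "\<forall>(n::nat) l r. (\<forall>i<n. l i \<le> r i \<and> {l i..r i} \<subseteq> {a..b}) \<longrightarrow>
      disjoint_family_on (\<lambda>i. {l i<..<r i}) {..<n} \<longrightarrow>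
      (\<Sum>i<n. r i - l i) < \<delta> \<longrightarrow> (\<Sum>i<n. norm (f (r i) - f (l i))) < e / 4"
      using ac unfolding absolutely_continuous_on_def by meson
    have N0: "N \<in> null_sets lebesgue"
      using N negligible_iff_null_sets by blast
    obtain T where T: "open T" "N \<subseteq> T" "T - N \<in> lmeasurable" "emeasure lebesgue (T - N) < ennreal \<delta>"
      using sets_lebesgue_outer_open[of N \<delta>] N0 \<open>\<delta> > 0\<close> by blast
    have Tsets: "T \<in> sets lebesgue" using T(1) by auto
    have "emeasure lebesgue T = emeasure lebesgue (T - N)"
      using emeasure_Diff_null_set[OF N0 Tsets] by simp
    with T(4) have eT: "emeasure lebesgue T < ennreal \<delta>" by simp
    then have lT: "T \<in> lmeasurable"
      using Tsets by (intro fmeasurableI) (auto intro: less_trans)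
    have mT: "measure lebesgue T < \<delta>"
      using eT \<open>\<delta> > 0\<close> emeasure_eq_measure2[OF lT] by (simp add: ennreal_less_iff)
    have "\<forall>x. \<exists>d>0. x \<in> {a..b} - N \<longrightarrow>
         (\<forall>y\<in>{a..b}. norm (y-x) < d \<longrightarrow> norm (f y - f x - (y-x) *\<^sub>R D x) \<le> e' * norm (y-x))"
      using der e'(1) unfolding has_vector_derivative_def has_derivative_within_alt by (meson zero_less_one)
    then obtain d where d: "\<And>x. 0 < d x"
      "\<And>x y. \<lbrakk>x \<in> {a..b} - N; y \<in> {a..b}; norm (y-x) < d x\<rbrakk>
         \<Longrightarrow> norm (f y - f x - (y-x) *\<^sub>R D x) \<le> e' * norm (y-x)"
      by metis
    define \<gamma> where "\<gamma> x = (if x \<in> N then T else ball x (d x))" for x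
    have A1: "gauge \<gamma>"
      unfolding gauge_def \<gamma>_def using T d(1) by auto
    have A2: "norm ((\<Sum>(x,k)\<in>p. measure lborel k *\<^sub>R D' x) - (f b - f a)) < e"
      if p: "p tagged_division_of {a..b}" and fine: "\<gamma> fine p" for p
    proof -
      have fin: "finite p" using p by blast
      have form: "\<exists>u v. K = {u..v} \<and> u \<le> v \<and> x \<in> {u..v} \<and> {u..v} \<subseteq> {a..b}" if "(x, K) \<in> p" for x K
      proof -
        have "x \<in> K" "K \<subseteq> {a..b}" "\<exists>u v. K = cbox u v"
          using p that by blast+
        then show ?thesis by fastforce
      qed
      define P where "P = {z \<in> p. fst z \<in> N}"
      have split: "p = P \<union> (p - P)" "P \<inter> (p - P) = {}" "finite P" "finite (p - P)"
        using fin by (auto simp: P_def)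
      let ?g = "\<lambda>z. measure lborel (snd z) *\<^sub>R D' (fst z) - (f (Sup (snd z)) - f (Inf (snd z)))"
      let ?L = "\<lambda>z. Sup (snd z) - Inf (snd z)"
      have ba: "b - a = (\<Sum>z\<in>p. ?L z)" "f b - f a = (\<Sum>z\<in>p. f (Sup (snd z)) - f (Inf (snd z)))"
        using additive_tagged_division_1[where f= "\<lambda>x. x", OF \<open>a \<le> b\<close> p]
          additive_tagged_division_1[where f= f, OF \<open>a \<le> b\<close> p]
        by (auto simp: split_def)
      have Lnn: "?L z \<ge> 0" if "z \<in> p" for z
        using form[of "fst z" "snd z"] that by auto
      have good: "norm (?g z) \<le> e' * ?L z" if "z \<in> p - P" for z
      proof -
        obtain x K where z: "z = (x, K)" by (cases z)
        have xN: "x \<notin> N" and zp: "(x, K) \<in> p" using that z by (auto simp: P_def)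
        obtain u v where uv: "K = {u..v}" "u \<le> v" "x \<in> {u..v}" "{u..v} \<subseteq> {a..b}"
          using form[OF zp] by blast
        have "K \<subseteq> ball x (d x)" using fineD[OF fine zp] xN by (simp add: \<gamma>_def)
        moreover have "u \<in> K" "v \<in> K" using uv by auto
        ultimately have "u \<in> ball x (d x)" "v \<in> ball x (d x)" by blast+
        then have du: "norm (u - x) < d x" "norm (v - x) < d x"
          by (auto simp: dist_real_def)
        have xin: "x \<in> {a..b} - N" "u \<in> {a..b}" "v \<in> {a..b}" using uv xN by auto
        have "norm ((v - u) *\<^sub>R D x - (f v - f u)) =
            norm (f u - f x - (u - x) *\<^sub>R D x - (f v - f x - (v - x) *\<^sub>R D x))"
          by (auto simp: algebra_simps)
        also have "\<dots> \<le> norm (f u - f x - (u - x) *\<^sub>R D x) + norm (f v - f x - (v - x) *\<^sub>R D x)"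
          by (rule norm_triangle_ineq4)
        also have "\<dots> \<le> e' * norm (u - x) + e' * norm (v - x)"
          by (intro add_mono d(2) xin du)
        also have "\<dots> = e' * (v - u)"
          using uv by (auto simp: algebra_simps)
        finally show ?thesis
          using uv xN by (simp add: z D'_def)
      qed
      have 1: "norm (\<Sum>z\<in>p - P. ?g z) \<le> e / 4"
      proof -
        have "norm (\<Sum>z\<in>p - P. ?g z) \<le> (\<Sum>z\<in>p - P. e' * ?L z)"
          by (rule sum_norm_le) (rule good)
        also have "\<dots> = e' * (\<Sum>z\<in>p - P. ?L z)" by (simp add: sum_distrib_left)
        also have "\<dots> \<le> e' * (b - a)"
          unfolding ba using e'(1) Lnn fin by (intro mult_left_mono sum_mono2) auto
        finally show ?thesis using e'(2) by linarith
      qed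
      have disj: "disjoint_family_on (\<lambda>z. {Inf (snd z)<..<Sup (snd z)}) P"
        unfolding disjoint_family_on_def
      proof (intro ballI impI)
        fix z z' assume zz: "z \<in> P" "z' \<in> P" "z \<noteq> z'"
        then have zp: "(fst z, snd z) \<in> p" "(fst z', snd z') \<in> p" by (auto simp: P_def)
        then have "interior (snd z) \<inter> interior (snd z') = {}"
          using zz tagged_division_ofD(5)[OF p] by (metis prod.collapse)
        moreover obtain u v where "snd z = {u..v}" "u \<le> v" using form[OF zp(1)] by blast
        moreover obtain u' v' where "snd z' = {u'..v'}" "u' \<le> v'" using form[OF zp(2)] by blast
        ultimately show "{Inf (snd z)<..<Sup (snd z)} \<inter> {Inf (snd z')<..<Sup (snd z')} = {}"
          by (simp add: interior_atLeastAtMost_real)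
      qed
      have len: "(\<Sum>z\<in>P. ?L z) < \<delta>"
      proof -
        have "(\<Sum>z\<in>P. ?L z) = (\<Sum>z\<in>P. measure lebesgue {Inf (snd z)<..<Sup (snd z)})"
          using Lnn by (intro sum.cong) (auto simp: P_def)
        also have "\<dots> = measure lebesgue (\<Union>z\<in>P. {Inf (snd z)<..<Sup (snd z)})"
        proof (rule measure_finite_Union[symmetric])
          show "emeasure lebesgue {Inf (snd z)<..<Sup (snd z)} \<noteq> \<infinity>" for z :: "real \<times> real set"
            using emeasure_lborel_box_finite[of "Inf (snd z)" "Sup (snd z)"] by simp
        qed (use split(3) disj in auto)
        also have "\<dots> \<le> measure lebesgue T"
        proof (rule measure_mono_fmeasurable)
          show "(\<Union>z\<in>P. {Inf (snd z)<..<Sup (snd z)}) \<subseteq> T"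
          proof (rule UN_least)
            fix z assume z: "z \<in> P"
            then have zp: "(fst z, snd z) \<in> p" "fst z \<in> N" by (auto simp: P_def)
            then have "snd z \<subseteq> T" using fine unfolding fine_def \<gamma>_def by force
            then show "{Inf (snd z)<..<Sup (snd z)} \<subseteq> T"
              using form[OF zp(1)] by force
          qed
          show "(\<Union>z\<in>P. {Inf (snd z)<..<Sup (snd z)}) \<in> sets lebesgue"
            by (intro sets.finite_UN split(3)) auto
        qed (use lT in auto)
        finally show ?thesis using mT by simp
      qed
      have 2: "norm (\<Sum>z\<in>P. ?g z) < e / 4"
      proof -
        have "norm (\<Sum>z\<in>P. ?g z) \<le> (\<Sum>z\<in>P. norm (f (Sup (snd z)) - f (Inf (snd z))))"
          by (rule sum_norm_le) (auto simp: P_def D'_def norm_minus_commute)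
        also have "\<dots> < e / 4"
        proof (rule absolutely_continuous_on_finite_family[OF \<delta> split(3) _ disj len])
          show "Inf (snd z) \<le> Sup (snd z) \<and> {Inf (snd z)..Sup (snd z)} \<subseteq> {a..b}" if "z \<in> P" for z
            using form[of "fst z" "snd z"] that by (auto simp: P_def)
        qed
        finally show ?thesis .
      qed
      have "(\<Sum>(x,k)\<in>p. measure lborel k *\<^sub>R D' x) - (f b - f a) = (\<Sum>z\<in>p. ?g z)"
        unfolding ba by (simp add: split_def sum_subtractf)
      also have "\<dots> = (\<Sum>z\<in>P. ?g z) + (\<Sum>z\<in>p - P. ?g z)"
        using sum.union_disjoint[OF split(3,4,2), of ?g] split(1) by simp
      finally have eq: "(\<Sum>(x,k)\<in>p. measure lborel k *\<^sub>R D' x) - (f b - f a) = (\<Sum>z\<in>P. ?g z) + (\<Sum>z\<in>p - P. ?g z)" .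
      show ?thesis
        unfolding eq
        using 1 2 norm_triangle_ineq[of "\<Sum>z\<in>P. ?g z" "\<Sum>z\<in>p - P. ?g z"] \<open>e > 0\<close> by linarith
    qed
    show "\<exists>\<gamma>. gauge \<gamma> \<and> (\<forall>p. p tagged_division_of {a..b} \<and> \<gamma> fine p \<longrightarrow>
        norm ((\<Sum>(x,k)\<in>p. measure lborel k *\<^sub>R D' x) - (f b - f a)) < e)"
      by (intro exI[of _ \<gamma>] conjI allI impI A1 A2) auto
  qed
qed

lemma absolutely_continuous_on_mult:
  fixes f g :: "real \<Rightarrow> 'a::real_normed_algebra"
  assumes f: "absolutely_continuous_on S f" and g: "absolutely_continuous_on S g"
    and B: "\<And>t. t \<in> S \<Longrightarrow> norm (f t) \<le> B" "\<And>t. t \<in> S \<Longrightarrow> norm (g t) \<le> B"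
  shows "absolutely_continuous_on S (\<lambda>t. f t * g t)"
  unfolding absolutely_continuous_on_def
proof (intro allI impI)
  fix \<epsilon> :: real assume "\<epsilon> > 0"
  \<comment> \<open>The final bound is \<open>2 * \<bar>B\<bar> * \<eta>\<close>; the summand 1
    makes it strictly smaller than \<open>\<epsilon>\<close> and covers \<open>B = 0\<close>. The
    absolute value is there because \<open>B\<close> may be negative when \<open>S\<close> is
    empty.\<close>
  define \<eta> where "\<eta> = \<epsilon> / (2 * (\<bar>B\<bar> + 1))"
  have "\<eta> > 0" using \<open>\<epsilon> > 0\<close> by (simp add: \<eta>_def)
  obtain \<delta>1 where \<delta>1: "\<delta>1 > 0" "\<And>(n::nat) a b. (\<forall>i<n. a i \<le> b i \<and> {a i..b i} \<subseteq> S) \<Longrightarrow>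
        disjoint_family_on (\<lambda>i. {a i<..<b i}) {..<n} \<Longrightarrow>
        (\<Sum>i<n. b i - a i) < \<delta>1 \<Longrightarrow> (\<Sum>i<n. norm (f (b i) - f (a i))) < \<eta>"
    using f \<open>\<eta> > 0\<close> unfolding absolutely_continuous_on_def by meson
  obtain \<delta>2 where \<delta>2: "\<delta>2 > 0" "\<And>(n::nat) a b. (\<forall>i<n. a i \<le> b i \<and> {a i..b i} \<subseteq> S) \<Longrightarrow>
        disjoint_family_on (\<lambda>i. {a i<..<b i}) {..<n} \<Longrightarrow>
        (\<Sum>i<n. b i - a i) < \<delta>2 \<Longrightarrow> (\<Sum>i<n. norm (g (b i) - g (a i))) < \<eta>"
    using g \<open>\<eta> > 0\<close> unfolding absolutely_continuous_on_def by meson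
  show "\<exists>\<delta>>0. \<forall>(n::nat) a b. (\<forall>i<n. a i \<le> b i \<and> {a i..b i} \<subseteq> S) \<longrightarrow>
        disjoint_family_on (\<lambda>i. {a i<..<b i}) {..<n} \<longrightarrow> (\<Sum>i<n. b i - a i) < \<delta> \<longrightarrow>
        (\<Sum>i<n. norm (f (b i) * g (b i) - f (a i) * g (a i))) < \<epsilon>"
  proof (intro exI[of _ "min \<delta>1 \<delta>2"] conjI allI impI)
    show "0 < min \<delta>1 \<delta>2" using \<delta>1(1) \<delta>2(1) by simp
    fix n :: nat and a b :: "nat \<Rightarrow> real"
    assume *: "\<forall>i<n. a i \<le> b i \<and> {a i..b i} \<subseteq> S" "disjoint_family_on (\<lambda>i. {a i<..<b i}) {..<n}"
      "(\<Sum>i<n. b i - a i) < min \<delta>1 \<delta>2"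
    have s: "(\<Sum>i<n. norm (f (b i) - f (a i))) < \<eta>" "(\<Sum>i<n. norm (g (b i) - g (a i))) < \<eta>"
      using \<delta>1(2)[of n a b] \<delta>2(2)[of n a b] * by auto
    have "(\<Sum>i<n. norm (f (b i) * g (b i) - f (a i) * g (a i)))
        \<le> (\<Sum>i<n. \<bar>B\<bar> * norm (f (b i) - f (a i)) + \<bar>B\<bar> * norm (g (b i) - g (a i)))"
    proof (rule sum_mono)
      fix i assume "i \<in> {..<n}"
      then have S: "a i \<in> S" "b i \<in> S" using *(1) by fastforce+
      have "f (b i) * g (b i) - f (a i) * g (a i) = (f (b i) - f (a i)) * g (b i) + f (a i) * (g (b i) - g (a i))"
        by (simp add: algebra_simps)
      then have "norm (f (b i) * g (b i) - f (a i) * g (a i))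
        \<le> norm (f (b i) - f (a i)) * norm (g (b i)) + norm (f (a i)) * norm (g (b i) - g (a i))"
        by (metis add_mono norm_mult_ineq norm_triangle_le)
      also have "\<dots> \<le> norm (f (b i) - f (a i)) * \<bar>B\<bar> + \<bar>B\<bar> * norm (g (b i) - g (a i))"
        using B S by (intro add_mono mult_mono) (auto intro: order_trans[OF _ abs_ge_self])
      finally show "norm (f (b i) * g (b i) - f (a i) * g (a i))
        \<le> \<bar>B\<bar> * norm (f (b i) - f (a i)) + \<bar>B\<bar> * norm (g (b i) - g (a i))"
        by (simp add: mult.commute)
    qed
    also have "\<dots> = \<bar>B\<bar> * ((\<Sum>i<n. norm (f (b i) - f (a i))) + (\<Sum>i<n. norm (g (b i) - g (a i))))"
      by (simp add: sum.distrib sum_distrib_left distrib_left)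
    also have "\<dots> \<le> \<bar>B\<bar> * (2 * \<eta>)"
      using s by (intro mult_left_mono) auto
    also have "\<dots> < \<epsilon>"
      using \<open>\<epsilon> > 0\<close> by (simp add: \<eta>_def field_simps)
    finally show "(\<Sum>i<n. norm (f (b i) * g (b i) - f (a i) * g (a i))) < \<epsilon>" .
  qed
qed

section \<open>Propagation of decay\<close>

text \<open>A mean value inequality with an exceptional null set. On \<open>N\<close> the derivative
  is replaced by 0, which is where \<open>g' >= 0\<close> enters.\<close>

lemma absolutely_continuous_on_increment_bound:
  fixes f :: "real \<Rightarrow> 'a::euclidean_space"
  assumes "a \<le> b" and ac: "absolutely_continuous_on {a..b} f" and N: "negligible N"
    and der: "\<And>t. t \<in> {a..b} - N \<Longrightarrow> (f has_vector_derivative D t) (at t within {a..b})"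
    and bound: "\<And>t. t \<in> {a..b} - N \<Longrightarrow> norm (D t) \<le> g' t"
    and g: "\<And>t. t \<in> {a..b} \<Longrightarrow> (g has_real_derivative g' t) (at t)"
    and g0: "\<And>t. t \<in> {a..b} \<Longrightarrow> g' t \<ge> 0"
  shows "norm (f b - f a) \<le> g b - g a"
proof -
  define D' where "D' t = (if t \<in> N then 0 else D t)" for t
  have f_int: "(D' has_integral (f b - f a)) {a..b}"
    by (rule absolutely_continuous_on_FTC[OF \<open>a \<le> b\<close> ac N]) (use der in \<open>auto simp: D'_def\<close>)
  have g_int: "(g' has_integral (g b - g a)) {a..b}"
  proof (rule fundamental_theorem_of_calculus[OF \<open>a \<le> b\<close>])
    show "(g has_vector_derivative g' t) (at t within {a..b})" if "t \<in> {a..b}" for t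
      using g[OF that] by (simp add: has_real_derivative_iff_has_vector_derivative has_vector_derivative_at_within)
  qed
  have "norm (integral {a..b} D') \<le> integral {a..b} g'"
    by (rule integral_norm_bound_integral)
       (use f_int g_int bound g0 in \<open>auto simp: D'_def\<close>)
  with f_int g_int show ?thesis
    by (simp add: integral_unique)
qed

text \<open>The graph distance to the origin. One application of the Laplacian changes it by at most
  1, so a majorant \<open>A / X ^ l1 j\<close> loses at most a factor \<open>X\<close> in passing to
  a neighbour.\<close>

definition l1 :: "int ^ 'd::finite \<Rightarrow> nat" where
  "l1 j = (\<Sum>k\<in>UNIV. nat \<bar>j $ k\<bar>)"

lemma l1_triangle: "l1 (i + j) \<le> l1 i + l1 j"
  unfolding l1_def sum.distrib[symmetric] by (rule sum_mono) auto

lemma l1_uminus [simp]: "l1 (- j) = l1 j"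
  by (simp add: l1_def)

lemma l1_axis [simp]: "l1 (axis k a) = nat \<bar>a\<bar>"
proof -
  have "l1 (axis k a) = (\<Sum>i\<in>UNIV. if i = k then nat \<bar>a\<bar> else 0)"
    unfolding l1_def by (rule sum.cong) (auto simp: axis_def)
  then show ?thesis by simp
qed

lemma l1_le_add: "l1 j \<le> l1 (j + i) + l1 i"
  using l1_triangle[of "j + i" "- i"] by simp

section \<open>Uniform bounds for families in \<open>ell2\<close>\<close>

lemma ell2_diff:
  assumes "f \<in> ell2" "g \<in> ell2"
  shows "(\<lambda>j. f j - g j) \<in> ell2"
proof -
  have "(\<lambda>j. 2 * (cmod (f j))\<^sup>2 + 2 * (cmod (g j))\<^sup>2) summable_on UNIV"
    using assms by (auto simp: ell2_def intro!: summable_on_add summable_on_cmult_right)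
  moreover have "(cmod (f j - g j))\<^sup>2 \<le> 2 * (cmod (f j))\<^sup>2 + 2 * (cmod (g j))\<^sup>2" for j
  proof -
    have "(cmod (f j - g j))\<^sup>2 \<le> (cmod (f j) + cmod (g j))\<^sup>2"
      by (intro power_mono norm_triangle_ineq4) auto
    also have "\<dots> \<le> 2 * (cmod (f j))\<^sup>2 + 2 * (cmod (g j))\<^sup>2"
      using sum_squares_bound[of "cmod (f j)" "cmod (g j)"] by (simp add: power2_sum)
    finally show ?thesis .
  qed
  ultimately show ?thesis
    unfolding ell2_def by (auto intro: summable_on_comparison_test)
qed

lemma cmod_le_ell2_norm:
  assumes "f \<in> ell2"
  shows "cmod (f j) \<le> ell2_norm f"
proof -
  have "(\<Sum>i\<in>{j}. (cmod (f i))\<^sup>2) \<le> (\<Sum>\<^sub>\<infinity>i. (cmod (f i))\<^sup>2)"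
    using assms by (intro finite_sum_le_infsum) (auto simp: ell2_def)
  then show ?thesis
    unfolding ell2_norm_def by (intro real_le_rsqrt) simp
qed

text \<open>Continuity at \<open>t\<close> bounds all components at once on a neighbourhood of
  \<open>t\<close>, and finitely many neighbourhoods cover \<open>S\<close>. The time
  \<open>t\<close> itself is treated apart because the limit is taken over a punctured
  neighbourhood.\<close>

lemma ell2_continuous_on_bounded:
  assumes S: "compact S" and u: "ell2_continuous_on S u"
  obtains C where "C \<ge> 0" "\<And>t j. t \<in> S \<Longrightarrow> cmod (u t j) \<le> C"
proof -
  have "\<exists>U. open U \<and> t \<in> U \<and> (\<exists>C. \<forall>s\<in>U \<inter> S. \<forall>j. cmod (u s j) \<le> C)" if t: "t \<in> S" for t
  proof -
    have ut: "u t \<in> ell2" and lim: "((\<lambda>s. ell2_norm (\<lambda>j. u s j - u t j)) \<longlongrightarrow> 0) (at t within S)"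
      using u t by (auto simp: ell2_continuous_on_def)
    have "eventually (\<lambda>s. ell2_norm (\<lambda>j. u s j - u t j) < 1) (at t within S)"
      using order_tendstoD(2)[OF lim] by simp
    then obtain U where U: "open U" "t \<in> U"
      "\<And>s. s \<in> U \<Longrightarrow> s \<noteq> t \<Longrightarrow> s \<in> S \<Longrightarrow> ell2_norm (\<lambda>j. u s j - u t j) < 1"
      unfolding eventually_at_topological by blast
    have "cmod (u s j) \<le> ell2_norm (u t) + 1" if "s \<in> U \<inter> S" for s j
    proof (cases "s = t")
      case True
      then show ?thesis using cmod_le_ell2_norm[OF ut, of j] by simp
    next
      case False
      have us: "u s \<in> ell2" using u that by (auto simp: ell2_continuous_on_def)
      have "cmod (u s j - u t j) \<le> ell2_norm (\<lambda>j. u s j - u t j)"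
        using cmod_le_ell2_norm[OF ell2_diff[OF us ut]] .
      also have "\<dots> < 1" using U(3) that False by blast
      finally show ?thesis
        using cmod_le_ell2_norm[OF ut, of j] norm_triangle_ineq2[of "u s j" "u t j"] by linarith
    qed
    with U show ?thesis by blast
  qed
  then obtain U where U: "\<And>t. t \<in> S \<Longrightarrow> open (U t)" "\<And>t. t \<in> S \<Longrightarrow> t \<in> U t"
    "\<And>t. t \<in> S \<Longrightarrow> \<exists>C. \<forall>s\<in>U t \<inter> S. \<forall>j. cmod (u s j) \<le> C"
    by metis
  then obtain C where C: "\<And>t s j. t \<in> S \<Longrightarrow> s \<in> U t \<inter> S \<Longrightarrow> cmod (u s j) \<le> C t"
    by metis
  obtain T where T: "T \<subseteq> S" "finite T" "S \<subseteq> (\<Union>t\<in>T. U t)"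
    by (rule compactE_image[OF S, of S U]) (use U in auto)
  show thesis
  proof
    show "0 \<le> Max (insert 0 (C ` T))" using T(2) by simp
    fix t j assume "t \<in> S"
    then obtain s where "s \<in> T" "t \<in> U s" using T(3) by blast
    then have "cmod (u t j) \<le> C s" using C T(1) \<open>t \<in> S\<close> by blast
    also have "\<dots> \<le> Max (insert 0 (C ` T))" using T(2) \<open>s \<in> T\<close> by simp
    finally show "cmod (u t j) \<le> Max (insert 0 (C ` T))" .
  qed
qed

locale bounded_schroedinger =
  fixes V u :: "real \<Rightarrow> int ^ 'd::finite \<Rightarrow> complex" and M :: real
  assumes sol: "schroedinger_solution V u"
    and potential_bound: "\<And>t j. t \<in> {0..1} \<Longrightarrow> cmod (V t j) \<le> M"
begin

lemma M_nonneg: "M \<ge> 0"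
  using order_trans[OF norm_ge_zero potential_bound[of 0 0]] by simp

definition velocity :: "real \<Rightarrow> int ^ 'd \<Rightarrow> complex" where
  "velocity t j = \<i> * (discrete_laplacian (u t) j + V t j * u t j)"

lemma component_AC: "absolutely_continuous_on {0..1} (\<lambda>t. u t j)"
  using sol by (simp add: schroedinger_solution_def)

lemma component_derivative:
  obtains N where "negligible N"
    "\<And>t. t \<in> {0..1} - N \<Longrightarrow> ((\<lambda>s. u s j) has_vector_derivative velocity t j) (at t within {0..1})"
proof -
  have "AE t in lebesgue_on {0..1}. ((\<lambda>s. u s j) has_vector_derivative velocity t j) (at t within {0..1})"
    using sol by (simp add: schroedinger_solution_def velocity_def)
  then have "AE t in lebesgue. t \<in> {0..1} \<longrightarrow> ((\<lambda>s. u s j) has_vector_derivative velocity t j) (at t within {0..1})"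
    by (subst (asm) AE_restrict_space_iff) auto
  then show thesis
    using that unfolding eventually_ae_filter_negligible by blast
qed

lemma u_bounded:
  obtains C where "C \<ge> 0" "\<And>t j. t \<in> {0..1} \<Longrightarrow> cmod (u t j) \<le> C"
  using ell2_continuous_on_bounded[of "{0..1}" u] sol
  by (auto simp: schroedinger_solution_def)

text \<open>The majorant is split into a decaying part, which costs a factor \<open>X\<close> at
  each neighbour, and a uniform error \<open>z\<close>, which costs nothing there. The two
  coefficients become the growth rates \<open>\<gamma>\<close> and \<open>\<Lambda>\<close> of the
  comparison argument.\<close>

lemma velocity_bound:
  assumes t: "t \<in> {0..1}" and X: "X \<ge> 1" and "A \<ge> 0" "z \<ge> 0"
    and u: "\<And>j. cmod (u t j) \<le> A / X ^ l1 j + z"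
  shows "cmod (velocity t j) \<le> (2 * real CARD('d) * X + 2 * real CARD('d) + M) * (A / X ^ l1 j) + (4 * real CARD('d) + M) * z"
proof -
  define y where "y = A / X ^ l1 j"
  have y: "y \<ge> 0" using assms by (simp add: y_def)
  have nb: "cmod (u t (j + i)) \<le> X * y + z" if "l1 i = 1" for i
  proof -
    have "X ^ l1 j \<le> X ^ (l1 (j + i) + 1)"
      using l1_le_add[of j i] that X by (intro power_increasing) auto
    then have "A * X ^ l1 j \<le> A * (X ^ l1 (j + i) * X)"
      using \<open>A \<ge> 0\<close> by (intro mult_left_mono) (auto simp: mult.commute)
    then have "A / X ^ l1 (j + i) \<le> X * y"
      using X by (simp add: y_def field_simps)
    with u[of "j + i"] show ?thesis by linarith
  qed
  have "cmod (discrete_laplacian (u t) j) \<le> (\<Sum>k::'d\<in>UNIV. 2 * (X * y + z) + 2 * (y + z))"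
    unfolding discrete_laplacian_def
  proof (rule sum_norm_le)
    fix k :: 'd
    have "cmod (u t (j + axis k 1) - 2 * u t j + u t (j - axis k 1))
       \<le> cmod (u t (j + axis k 1)) + cmod (2 * u t j) + cmod (u t (j - axis k 1))"
      by (meson add_right_mono norm_triangle_ineq norm_triangle_ineq4 order_trans)
    moreover have "cmod (u t (j + axis k 1)) \<le> X * y + z" by (rule nb) simp
    moreover have "cmod (u t (j - axis k 1)) \<le> X * y + z" using nb[of "- axis k 1"] by simp
    moreover have "cmod (u t j) \<le> y + z" using u[of j] by (simp add: y_def)
    ultimately show "cmod (u t (j + axis k 1) - 2 * u t j + u t (j - axis k 1))
       \<le> 2 * (X * y + z) + 2 * (y + z)" by (simp add: norm_mult)
  qed
  also have "\<dots> = real CARD('d) * (2 * (X * y + z) + 2 * (y + z))" by simp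
  finally have 1: "cmod (discrete_laplacian (u t) j) \<le> real CARD('d) * (2 * (X * y + z) + 2 * (y + z))" .
  have "cmod (V t j * u t j) \<le> M * (y + z)"
    unfolding norm_mult using potential_bound[OF t] u[of j] M_nonneg
    by (intro mult_mono) (auto simp: y_def)
  with 1 have "cmod (velocity t j) \<le> real CARD('d) * (2 * (X * y + z) + 2 * (y + z)) + M * (y + z)"
    using norm_triangle_ineq[of "discrete_laplacian (u t) j" "V t j * u t j"]
    unfolding velocity_def norm_mult[of \<i>] by simp
  also have "\<dots> = (2 * real CARD('d) * X + 2 * real CARD('d) + M) * y + (4 * real CARD('d) + M) * z"
    by (simp add: algebra_simps)
  finally show ?thesis by (simp add: y_def)
qed

text \<open>Comparison with the supersolution \<open>A exp (\<gamma> t) / X ^ l1 j\<close> of the dominating positive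
  system; the error term is improved by one Picard iteration per step.\<close>

lemma decay_propagation:
  assumes X: "X \<ge> 1" and A: "A \<ge> 0" and u0: "\<And>j. cmod (u 0 j) \<le> A / X ^ l1 j"
    and t: "t \<in> {0..1}"
  shows "cmod (u t j) \<le> A * exp ((2 * real CARD('d) * X + 2 * real CARD('d) + M) * t) / X ^ l1 j"
proof -
  define \<gamma> where "\<gamma> = 2 * real CARD('d) * X + 2 * real CARD('d) + M"
  define \<Lambda> where "\<Lambda> = 4 * real CARD('d) + M"
  obtain C where C: "C \<ge> 0" "\<And>t j. t \<in> {0..1} \<Longrightarrow> cmod (u t j) \<le> C"
    using u_bounded by blast
  have pos: "\<gamma> \<ge> 0" "\<Lambda> \<ge> 0" using M_nonneg X by (auto simp: \<gamma>_def \<Lambda>_def)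
  have iter: "\<forall>t\<in>{0..1}. \<forall>j. cmod (u t j) \<le> A * exp (\<gamma> * t) / X ^ l1 j + C * (\<Lambda> * t) ^ m / fact m" for m
  proof (induction m)
    case 0
    show ?case
    proof (intro ballI allI)
      fix t :: real and j :: "int ^ 'd" assume "t \<in> {0..1}"
      then have "cmod (u t j) \<le> C" using C by blast
      moreover have "0 \<le> A * exp (\<gamma> * t) / X ^ l1 j" using A X by simp
      ultimately show "cmod (u t j) \<le> A * exp (\<gamma> * t) / X ^ l1 j + C * (\<Lambda> * t) ^ 0 / fact 0" by simp
    qed
  next
    case (Suc m)
    show ?case
    proof (intro ballI allI)
      fix t :: real and j :: "int ^ 'd" assume t: "t \<in> {0..1}"
      obtain N where N: "negligible N"
        "\<And>t. t \<in> {0..1} - N \<Longrightarrow> ((\<lambda>s. u s j) has_vector_derivative velocity t j) (at t within {0..1})"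
        using component_derivative by blast
      \<comment> \<open>\<open>g'\<close> is the bound of \<open>velocity_bound\<close> for the
        majorant of stage \<open>m\<close>, and \<open>g\<close> is its primitive whose value at 0
        is the bound for the initial datum.\<close>
      define g where "g s = A * exp (\<gamma> * s) / X ^ l1 j + C * (\<Lambda> * s) ^ Suc m / fact (Suc m)" for s
      define g' where "g' s = \<gamma> * (A * exp (\<gamma> * s) / X ^ l1 j) + \<Lambda> * (C * (\<Lambda> * s) ^ m / fact m)" for s
      have "cmod (u t j - u 0 j) \<le> g t - g 0"
      proof (rule absolutely_continuous_on_increment_bound[where N = N and D = "\<lambda>s. velocity s j" and g' = g'])
        show "absolutely_continuous_on {0..t} (\<lambda>t. u t j)"
          by (rule absolutely_continuous_on_subset[OF component_AC]) (use t in auto)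
        show "((\<lambda>s. u s j) has_vector_derivative velocity s j) (at s within {0..t})" if "s \<in> {0..t} - N" for s
          by (rule has_vector_derivative_within_subset[OF N(2)]) (use that t in auto)
        show "cmod (velocity s j) \<le> g' s" if "s \<in> {0..t} - N" for s
        proof -
          have "cmod (velocity s j) \<le> (2 * real CARD('d) * X + 2 * real CARD('d) + M) * (A * exp (\<gamma> * s) / X ^ l1 j) + (4 * real CARD('d) + M) * (C * (\<Lambda> * s) ^ m / fact m)"
          proof (rule velocity_bound[OF _ X])
            show "s \<in> {0..1}" using that t by auto
            with Suc.IH show "cmod (u s j) \<le> A * exp (\<gamma> * s) / X ^ l1 j + C * (\<Lambda> * s) ^ m / fact m" for j
              by blast
            show "0 \<le> A * exp (\<gamma> * s)" using A by simp
            have "0 \<le> (\<Lambda> * s) ^ m" using pos that by simp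
            then show "0 \<le> C * (\<Lambda> * s) ^ m / fact m" using C(1) by simp
          qed
          then show ?thesis by (simp add: g'_def \<gamma>_def \<Lambda>_def)
        qed
        show "(g has_real_derivative g' s) (at s)" for s
        proof -
          have 1: "((\<lambda>s. A / X ^ l1 j * exp (\<gamma> * s)) has_real_derivative A / X ^ l1 j * (exp (\<gamma> * s) * \<gamma>)) (at s)"
            by (rule DERIV_cmult) (auto intro!: derivative_eq_intros)
          have 2: "((\<lambda>s. C * \<Lambda> ^ Suc m / fact (Suc m) * s ^ Suc m) has_real_derivative
              C * \<Lambda> ^ Suc m / fact (Suc m) * ((1 + real m) * s ^ m)) (at s)"
            using DERIV_cmult[OF DERIV_pow[of "Suc m" s UNIV], of "C * \<Lambda> ^ Suc m / fact (Suc m)"] by simp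
          have "C * \<Lambda> ^ Suc m / fact (Suc m) * ((1 + real m) * s ^ m) = C * \<Lambda> ^ Suc m * s ^ m / fact m"
            by (simp add: divide_simps)
          then have "A / X ^ l1 j * (exp (\<gamma> * s) * \<gamma>) + C * \<Lambda> ^ Suc m / fact (Suc m) * ((1 + real m) * s ^ m) = g' s"
            by (simp add: g'_def power_mult_distrib mult_ac)
          moreover have "g = (\<lambda>s. A / X ^ l1 j * exp (\<gamma> * s) + C * \<Lambda> ^ Suc m / fact (Suc m) * s ^ Suc m)"
            by (rule ext) (simp add: g_def power_mult_distrib)
          ultimately show ?thesis using DERIV_add[OF 1 2] by simp
        qed
        show "0 \<le> g' s" if "s \<in> {0..t}" for s
          using that pos A C X by (auto simp: g'_def intro!: add_nonneg_nonneg mult_nonneg_nonneg divide_nonneg_nonneg)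
      qed (use t N in auto)
      moreover have "g 0 = A / X ^ l1 j" by (simp add: g_def)
      moreover have "cmod (u t j) \<le> cmod (u t j - u 0 j) + cmod (u 0 j)"
        by (metis diff_add_cancel norm_triangle_ineq)
      ultimately have "cmod (u t j) \<le> g t" using u0[of j] by linarith
      then show "cmod (u t j) \<le> A * exp (\<gamma> * t) / X ^ l1 j + C * (\<Lambda> * t) ^ Suc m / fact (Suc m)"
        by (simp add: g_def)
    qed
  qed
  have "(\<lambda>m. (\<Lambda> * t) ^ m / fact m) \<longlonglongrightarrow> 0"
    using summable_LIMSEQ_zero[OF summable_exp[of "\<Lambda> * t"]] by (simp add: field_simps)
  then have "(\<lambda>m. A * exp (\<gamma> * t) / X ^ l1 j + C * ((\<Lambda> * t) ^ m / fact m)) \<longlonglongrightarrow> A * exp (\<gamma> * t) / X ^ l1 j + C * 0"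
    by (intro tendsto_intros)
  then show ?thesis
    using iter t unfolding \<gamma>_def[symmetric] by (intro LIMSEQ_le_const) auto
qed

end

section \<open>The weight\<close>

definition weight :: "real \<Rightarrow> int \<Rightarrow> real" where
  "weight K i = K ^ nat \<bar>i\<bar> * (\<Prod>m<nat \<bar>i\<bar>. 2 * real m + 1)"

lemma weight_0 [simp]: "weight K 0 = 1"
  by (simp add: weight_def)

lemma weight_1 [simp]: "weight K 1 = K" "weight K (- 1) = K"
  by (simp_all add: weight_def)

lemma weight_ge_1: "K \<ge> 1 \<Longrightarrow> weight K i \<ge> 1"
  unfolding weight_def by (intro mult_ge1_I one_le_power prod_ge_1) auto

lemma weight_pos: "K \<ge> 1 \<Longrightarrow> weight K i > 0"
  using weight_ge_1[of K i] by linarith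

text \<open>Treats both signs of \<open>i\<close> together: \<open>a\<close> is the weight at the
  neighbour nearer to the origin, and \<open>r\<close> and \<open>s\<close> are the ratios of the
  outward steps into and out of \<open>i\<close>. The relation \<open>s = r + 2 * K\<close> is the
  linear growth of these ratios. At the origin no neighbour is nearer, so that point is handled by
  hand below.\<close>

lemma weight_neighbours:
  assumes "K \<ge> 1" "i \<noteq> 0"
  obtains a r s where "a > 0" "r \<ge> K" "s = r + 2 * K" "weight K i = r * a"
    "weight K (i - 1) = a \<and> weight K (i + 1) = s * r * a \<or>
     weight K (i + 1) = a \<and> weight K (i - 1) = s * r * a"
proof -
  define m where "m = nat \<bar>i\<bar> - 1"
  define a where "a = weight K (int m)"
  define r where "r = K * (2 * real m + 1)"
  define s where "s = r + 2 * K"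
  have up: "weight K (int n + 1) = K * (2 * real n + 1) * weight K (int n)" for n
    by (simp add: weight_def nat_add_distrib)
  have sym: "weight K (- l) = weight K l" for l by (simp add: weight_def)
  have n: "nat \<bar>i\<bar> = Suc m" using assms by (simp add: m_def)
  have 1: "weight K (int m + 1) = r * a" using up[of m] by (simp add: a_def r_def)
  have 2: "weight K (int m + 2) = s * r * a"
    using up[of "Suc m"] 1 by (simp add: r_def s_def algebra_simps)
  have i: "i = int m + 1 \<or> i = - (int m + 1)" using n by linarith
  have m3: "- (2::int) - int m = - (int m + 2)" "- (1::int) - int m = - (int m + 1)" by simp_all
  have "weight K i = r * a" using i 1 sym by metis
  moreover have "weight K (i - 1) = a \<and> weight K (i + 1) = s * r * a \<or>
     weight K (i + 1) = a \<and> weight K (i - 1) = s * r * a"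
    using i
  proof
    assume i: "i = int m + 1"
    then have "i - 1 = int m" "i + 1 = int m + 2" by simp_all
    then show ?thesis using 2 by (simp only: a_def simp_thms)
  next
    assume i: "i = - (int m + 1)"
    then have "i + 1 = - int m" "i - 1 = - (int m + 2)" by simp_all
    then show ?thesis using 2 by (simp only: a_def sym simp_thms)
  qed
  moreover have "a > 0" using weight_pos assms by (simp add: a_def)
  moreover have "r \<ge> K" using assms by (simp add: r_def)
  ultimately show thesis using that s_def by blast
qed

text \<open>A bound for the log-convexity defect \<open>w+ w- / w - w\<close> relative to the
  geometric mean of the neighbouring weights. Away from the origin the defect is
  \<open>2 K a\<close> and the mean is at least \<open>K a\<close>, so 2 suffices; at the origin the
  defect is \<open>K^2 - 1\<close> and the mean is \<open>K\<close>, so the bound has to grow with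
  \<open>K\<close>.\<close>

definition cross_coeff :: "real \<Rightarrow> int \<Rightarrow> real" where
  "cross_coeff K i = (if i = 0 then K else 2)"

lemma weight_cross:
  assumes K: "K \<ge> 1"
  shows "(weight K (i + 1) * weight K (i - 1) / weight K i - weight K i) * (x * y)
    \<le> cross_coeff K i / 2 * (weight K (i + 1) * x\<^sup>2 + weight K (i - 1) * y\<^sup>2)"
    and "weight K (i + 1) * weight K (i - 1) / weight K i - weight K i \<ge> 0"
proof -
  \<comment> \<open>Used with \<open>q = s * r\<close>: after multiplication by \<open>a\<close> the
    outer neighbour carries \<open>s * r * a\<close>, the inner one \<open>a\<close>. Exchanging
    \<open>x\<close> and \<open>y\<close> covers the other sign of \<open>i\<close>.\<close>
  have base: "2 * K * (x * y) \<le> q * x\<^sup>2 + y\<^sup>2" if "q \<ge> K\<^sup>2" for q x y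
  proof -
    have "2 * K * (x * y) \<le> K\<^sup>2 * x\<^sup>2 + y\<^sup>2"
      using sum_squares_bound[of "K * x" y] by (simp add: power_mult_distrib mult_ac)
    also have "\<dots> \<le> q * x\<^sup>2 + y\<^sup>2" using that by (intro add_right_mono mult_right_mono) auto
    finally show ?thesis .
  qed
  have "(weight K (i + 1) * weight K (i - 1) / weight K i - weight K i) * (x * y)
    \<le> cross_coeff K i / 2 * (weight K (i + 1) * x\<^sup>2 + weight K (i - 1) * y\<^sup>2) \<and>
    weight K (i + 1) * weight K (i - 1) / weight K i - weight K i \<ge> 0"
  proof (cases "i = 0")
    case True
    have "(K\<^sup>2 - 1) * (x * y) \<le> (K\<^sup>2 - 1) * ((x\<^sup>2 + y\<^sup>2) / 2)"
      using sum_squares_bound[of x y] K by (intro mult_left_mono) auto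
    also have "\<dots> \<le> K\<^sup>2 * ((x\<^sup>2 + y\<^sup>2) / 2)" by (intro mult_right_mono) auto
    finally have "(K\<^sup>2 - 1) * (x * y) \<le> K\<^sup>2 * ((x\<^sup>2 + y\<^sup>2) / 2)" .
    then show ?thesis using True K one_le_power[of K 2]
      by (simp add: cross_coeff_def power2_eq_square algebra_simps)
  next
    case False
    then obtain a r s where *: "a > 0" "r \<ge> K" "s = r + 2 * K" "weight K i = r * a"
      "weight K (i - 1) = a \<and> weight K (i + 1) = s * r * a \<or>
       weight K (i + 1) = a \<and> weight K (i - 1) = s * r * a"
      using weight_neighbours[OF K] by blast
    have "r > 0" using * K by linarith
    have O: "weight K (i + 1) * weight K (i - 1) / weight K i - weight K i = 2 * K * a"
      using *(5) by (auto simp: *(4) *(3) algebra_simps) (use \<open>r > 0\<close> \<open>a > 0\<close> in \<open>auto simp: field_simps\<close>)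
    have q: "s * r \<ge> K\<^sup>2"
      unfolding power2_eq_square using * K by (intro mult_mono) auto
    have "2 * K * (x * y) * a \<le> (s * r * x\<^sup>2 + y\<^sup>2) * a" "2 * K * (x * y) * a \<le> (s * r * y\<^sup>2 + x\<^sup>2) * a"
      using base[OF q, of x y] base[OF q, of y x] \<open>a > 0\<close>
      by (auto intro!: mult_right_mono simp: mult_ac)
    then show ?thesis
      using *(5) False K \<open>a > 0\<close> unfolding O by (auto simp: cross_coeff_def algebra_simps)
  qed
  then show "(weight K (i + 1) * weight K (i - 1) / weight K i - weight K i) * (x * y)
    \<le> cross_coeff K i / 2 * (weight K (i + 1) * x\<^sup>2 + weight K (i - 1) * y\<^sup>2)"
    and "weight K (i + 1) * weight K (i - 1) / weight K i - weight K i \<ge> 0" by auto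
qed

lemma weight_log_convex:
  assumes "K \<ge> 1"
  shows "(weight K i)\<^sup>2 \<le> weight K (i + 1) * weight K (i - 1)"
  using weight_cross(2)[OF assms, of i] weight_pos[OF assms, of i]
  by (simp add: field_simps power2_eq_square)

text \<open>Away from the origin the curvature is at least \<open>K\<close> times the weight. The
  cross terms cost 2 times the weight, except at \<open>i = 1\<close> and \<open>i = -1\<close>,
  where the large coefficient at the origin raises the cost to \<open>K / 2 + 1\<close>. What is
  left there, \<open>K / 2 - 1\<close>, is the constant that enters \<open>\<kappa>\<close>. At the
  origin the curvature is \<open>K - 1 / K\<close>, which \<open>K >= 4\<close> makes large
  enough.\<close>

lemma weight_curvature:
  assumes K: "K \<ge> 4"
  shows "((cross_coeff K (i - 1) + cross_coeff K (i + 1)) / 2 + (K / 2 - 1)) * weight K i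
    \<le> (weight K (i + 1) + weight K (i - 1) - (weight K i)\<^sup>2 / weight K (i - 1) - (weight K i)\<^sup>2 / weight K (i + 1)) / 2"
proof (cases "i = 0")
  case True
  have "1 / K \<le> 1" using K by simp
  then have "K / 2 + 1 \<le> K - 1 / K" using K by linarith
  then show ?thesis using True by (simp add: cross_coeff_def)
next
  case False
  have "K \<ge> 1" using K by simp
  then obtain a r s where *: "a > 0" "r \<ge> K" "s = r + 2 * K" "weight K i = r * a"
      "weight K (i - 1) = a \<and> weight K (i + 1) = s * r * a \<or>
       weight K (i + 1) = a \<and> weight K (i - 1) = s * r * a"
    using weight_neighbours False by metis
  have pos: "r > 0" "s > 0" "s \<ge> r" using * K by linarith+
  have "(weight K (i + 1) + weight K (i - 1) - (weight K i)\<^sup>2 / weight K (i - 1) - (weight K i)\<^sup>2 / weight K (i + 1)) / 2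
     = (s * r * a + a - r\<^sup>2 * a - r * a / s) / 2"
    using *(5) pos \<open>a > 0\<close> by (auto simp: *(4) power2_eq_square field_simps)
  also have "\<dots> \<ge> K * (r * a)"
  proof -
    have "r * a / s \<le> a" using pos \<open>a > 0\<close> by (simp add: field_simps)
    moreover have "s * r * a - r\<^sup>2 * a = 2 * (K * (r * a))"
      by (simp add: *(3) power2_eq_square algebra_simps)
    moreover have "k \<le> (x + a - y - z) / 2" if "z \<le> a" "x - y = 2 * k" for x y z k :: real
      using that by simp
    ultimately show ?thesis by blast
  qed
  finally have E: "K * weight K i \<le> (weight K (i + 1) + weight K (i - 1) - (weight K i)\<^sup>2 / weight K (i - 1) - (weight K i)\<^sup>2 / weight K (i + 1)) / 2"
    by (simp add: *(4))
  have "(cross_coeff K (i - 1) + cross_coeff K (i + 1)) / 2 + (K / 2 - 1) \<le> K"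
    using K by (auto simp: cross_coeff_def field_simps)
  then have "((cross_coeff K (i - 1) + cross_coeff K (i + 1)) / 2 + (K / 2 - 1)) * weight K i \<le> K * weight K i"
    using weight_pos[OF \<open>K \<ge> 1\<close>, of i] by (intro mult_right_mono) auto
  with E show ?thesis by linarith
qed

section \<open>The weighted current at a fixed time\<close>

lemma infsum_shift:
  fixes f :: "'a::ab_group_add \<Rightarrow> 'b::{comm_monoid_add,t2_space}"
  shows "infsum (\<lambda>j. f (j + a)) UNIV = infsum f UNIV"
    and "(\<lambda>j. f (j + a)) summable_on UNIV \<longleftrightarrow> f summable_on UNIV"
proof -
  have "bij_betw (\<lambda>j. j + a) UNIV UNIV"
    by (rule bij_betw_byWitness[where f' = "\<lambda>j. j - a"]) auto
  then show "infsum (\<lambda>j. f (j + a)) UNIV = infsum f UNIV"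
    "(\<lambda>j. f (j + a)) summable_on UNIV \<longleftrightarrow> f summable_on UNIV"
    by (rule infsum_reindex_bij_betw, intro summable_on_reindex_bij_betw)
qed

lemma summable_on_dominated:
  fixes f T :: "'a \<Rightarrow> real"
  assumes "T summable_on A" "\<And>j. j \<in> A \<Longrightarrow> \<bar>f j\<bar> \<le> C * T j"
  shows "f summable_on A"
proof (rule abs_summable_summable)
  have "(\<lambda>j. C * T j) summable_on A" using assms(1) by (rule summable_on_cmult_right)
  then show "(\<lambda>j. norm (f j)) summable_on A"
    by (rule summable_on_comparison_test) (use assms(2) in auto)
qed

text \<open>Plays the part of summation by parts: an increment \<open>h k (j + e k) - h k j\<close>
  of a summable family has total sum 0, so a pointwise inequality has to hold only up to such
  increments.\<close>

lemma infsum_mono_mod_shifts: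
  fixes f g :: "'a::ab_group_add \<Rightarrow> real"
  assumes f: "f summable_on UNIV" and g: "g summable_on UNIV" and "finite S"
    and h: "\<And>k. k \<in> S \<Longrightarrow> h k summable_on UNIV"
    and le: "\<And>j. g j + (\<Sum>k\<in>S. h k (j + e k) - h k j) \<le> f j"
  shows "infsum g UNIV \<le> infsum f UNIV"
proof -
  have "((\<lambda>j. h k (j + e k) - h k j) has_sum 0) UNIV" if "k \<in> S" for k
  proof -
    have "((\<lambda>j. h k (j + e k)) has_sum infsum (h k) UNIV) UNIV"
      using has_sum_infsum[of "\<lambda>j. h k (j + e k)" UNIV] h[OF that] by (simp add: infsum_shift)
    moreover have "((\<lambda>j. - h k j) has_sum - infsum (h k) UNIV) UNIV"
      using h[OF that] by (simp add: has_sum_uminus)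
    ultimately have "((\<lambda>j. h k (j + e k) + - h k j) has_sum (infsum (h k) UNIV + - infsum (h k) UNIV)) UNIV"
      by (rule has_sum_add)
    then show ?thesis by simp
  qed
  with \<open>finite S\<close> have hs: "((\<lambda>j. \<Sum>k\<in>S. h k (j + e k) - h k j) has_sum 0) UNIV"
  proof (induction S rule: finite_induct)
    case (insert k S)
    have "((\<lambda>j. (h k (j + e k) - h k j) + (\<Sum>k\<in>S. h k (j + e k) - h k j)) has_sum (0 + 0)) UNIV"
      by (intro has_sum_add insert) (use insert in auto)
    then show ?case using insert by simp
  qed simp
  have "((\<lambda>j. g j + (\<Sum>k\<in>S. h k (j + e k) - h k j)) has_sum (infsum g UNIV + 0)) UNIV"
    by (intro has_sum_add hs) (use g in auto)
  then show ?thesis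
    using has_sum_mono[OF _ has_sum_infsum[OF f]] le by simp
qed

text \<open>Along a solution with state \<open>v\<close> and potential \<open>q\<close>, \<open>rate\<close> is the time derivative of \<open>flux\<close>,
  and \<open>|\<sigma>| = sqrt W |S f|\<close> in the notation of the introduction.  The hypothesis \<open>dom\<close> makes every
  sum below absolutely convergent.\<close>

locale weighted_state =
  fixes K M :: real and k0 :: "'d::finite" and v q :: "int ^ 'd \<Rightarrow> complex" and T :: "int ^ 'd \<Rightarrow> real"
  assumes K: "K \<ge> 4"
    and q: "\<And>j. cmod (q j) \<le> M"
    and T: "T summable_on UNIV"
    and dom: "\<And>j i a b. \<bar>i\<bar> \<le> 2 \<Longrightarrow> l1 a \<le> 2 \<Longrightarrow> l1 b \<le> 2 \<Longrightarrow>
      weight K (j $ k0 + i) * (cmod (v (j + a)) * cmod (v (j + b))) \<le> T j"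
begin

definition W :: "int ^ 'd \<Rightarrow> real" where "W j = weight K (j $ k0)"

definition e :: "int ^ 'd" where "e = axis k0 1"

definition c :: "int ^ 'd \<Rightarrow> real" where "c j = W (j + e) - W j"

definition flux :: "int ^ 'd \<Rightarrow> real" where
  "flux j = c j * Im (v (j + e) * cnj (v j))"

definition rate :: "int ^ 'd \<Rightarrow> real" where
  "rate j = c j * (Re (discrete_laplacian v (j + e) * cnj (v j) - v (j + e) * cnj (discrete_laplacian v j))
     + Re ((q (j + e) - cnj (q j)) * (v (j + e) * cnj (v j))))"

definition \<sigma> :: "int ^ 'd \<Rightarrow> complex" where
  "\<sigma> j = (c j * v (j + e) - c (j - e) * v (j - e)) / 2"

definition \<kappa> :: real where "\<kappa> = K / 2 - 1 - M\<^sup>2"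

lemma W_pos: "W j > 0" and W_ge_1: "W j \<ge> 1"
  using weight_pos[of K] weight_ge_1[of K] K by (auto simp: W_def)

lemma W_shift: "W (j + e) = weight K (j $ k0 + 1)" "W (j - e) = weight K (j $ k0 - 1)"
  "W (j + e + e) = weight K (j $ k0 + 2)"  "W (j - e - e) = weight K (j $ k0 - 2)"
  by (simp_all add: W_def e_def add.assoc)

lemma e_k0 [simp]: "e $ k0 = 1"
  by (simp add: e_def)

lemma W_axis: "k \<noteq> k0 \<Longrightarrow> W (j + axis k a) = W j" "k \<noteq> k0 \<Longrightarrow> W (j - axis k a) = W j"
  by (simp_all add: W_def axis_def)

lemma c_axis: "k \<noteq> k0 \<Longrightarrow> c (j + axis k a) = c j"
  using W_axis(1)[of k "j + e" a] W_axis(1)[of k j a] by (simp add: c_def add_ac)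

lemma M_nonneg: "M \<ge> 0"
  using order_trans[OF norm_ge_zero q[of 0]] .

lemma W_log_convex: "(W j)\<^sup>2 \<le> W (j + e) * W (j - e)"
  using weight_log_convex[of K "j $ k0"] K unfolding W_shift by (simp add: W_def)

lemma l1_e: "l1 e = 1" "l1 (e + e) \<le> 2" "l1 (- e - e) \<le> 2" "l1 (- e) = 1" "l1 0 = 0"
  using l1_triangle[of e e] l1_triangle[of "- e" "- e"] by (simp_all add: e_def) (simp add: l1_def)

lemma T_nonneg: "T j \<ge> 0"
  using dom[of 0 0 0 j] weight_pos[of K "j $ k0"] K by (auto simp: l1_e intro: order_trans[rotated])

text \<open>Completing the square against the off-diagonal term extracts \<open>2 |\<sigma>|\<^sup>2 / W\<close>; what is left is
  the discrete convexity of the weight, which beats the cross terms after shifting.\<close>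

definition A :: "int ^ 'd \<Rightarrow> real" where
  "A j = ((c j)\<^sup>2 / (2 * W j) + cross_coeff K (j $ k0) / 2 * W (j + e)) * (cmod (v (j + e)))\<^sup>2"

definition B :: "int ^ 'd \<Rightarrow> real" where
  "B j = ((c (j - e))\<^sup>2 / (2 * W j) + cross_coeff K (j $ k0) / 2 * W (j - e)) * (cmod (v (j - e)))\<^sup>2"

text \<open>Everything that telescopes in the direction \<open>e\<close>. Subtracting its increment
  from the longitudinal terms replaces the coefficient \<open>c j\<close> by the second difference
  \<open>c j - c (j - e)\<close>, makes both potential terms refer to the same \<open>q j\<close>,
  and moves the squares in \<open>A\<close> and \<open>B\<close> back to the site
  \<open>j\<close>.\<close>

definition h :: "int ^ 'd \<Rightarrow> real" where
  "h j = c (j - e) * (Re (v (j + e) * cnj (v (j - e))) - (cmod (v j))\<^sup>2 + Re (q j * v j * cnj (v (j - e))))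
     - A (j - e) + B j"

lemma local_estimate:
  "(W (j + e) - 2 * W j + W (j - e)) * ((cmod (v j))\<^sup>2 - Re (v (j + e) * cnj (v (j - e))))
   \<ge> 2 * (cmod (\<sigma> j))\<^sup>2 / W j + (K / 2 - 1) * W j * (cmod (v j))\<^sup>2
     + (A (j - e) - A j + B (j + e) - B j)"
proof -
  define w where "w = W j"
  define wp where "wp = W (j + e)"
  define wm where "wm = W (j - e)"
  define x where "x = v (j + e)"
  define y where "y = v (j - e)"
  define r where "r = (cmod (v j))\<^sup>2"
  define z where "z = Re (x * cnj y)"
  define o0 where "o0 = cross_coeff K (j $ k0)"
  define op where "op = cross_coeff K (j $ k0 + 1)"
  define om where "om = cross_coeff K (j $ k0 - 1)"
  have pos: "w > 0" "wp > 0" "wm > 0" "r \<ge> 0" by (simp_all add: w_def wp_def wm_def r_def W_pos)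
  have c: "c j = wp - w" "c (j - e) = w - wm" by (simp_all add: c_def w_def wp_def wm_def)
  have ek: "(j + e) $ k0 = j $ k0 + 1" "(j - e) $ k0 = j $ k0 - 1" by (simp_all add: e_def)
  have AB: "A j = ((wp - w)\<^sup>2 / (2 * w) + o0 / 2 * wp) * (cmod x)\<^sup>2"
    "B j = ((w - wm)\<^sup>2 / (2 * w) + o0 / 2 * wm) * (cmod y)\<^sup>2"
    "A (j - e) = ((w - wm)\<^sup>2 / (2 * wm) + om / 2 * w) * r"
    "B (j + e) = ((wp - w)\<^sup>2 / (2 * wp) + op / 2 * w) * r"
    by (simp_all only: A_def B_def c ek diff_add_cancel add_diff_cancel_right')
       (simp_all add: w_def wp_def wm_def x_def y_def r_def o0_def op_def om_def c)
  have sq: "2 * (cmod (\<sigma> j))\<^sup>2 / w = ((wp - w)\<^sup>2 * (cmod x)\<^sup>2 + (w - wm)\<^sup>2 * (cmod y)\<^sup>2 - 2 * (wp - w) * (w - wm) * z) / (2 * w)"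
  proof -
    have "4 * (cmod (\<sigma> j))\<^sup>2 = (cmod (of_real (wp - w) * x - of_real (w - wm) * y))\<^sup>2"
      by (simp add: \<sigma>_def c x_def y_def norm_divide power_divide)
    also have "\<dots> = (wp - w)\<^sup>2 * (cmod x)\<^sup>2 + (w - wm)\<^sup>2 * (cmod y)\<^sup>2 - 2 * (wp - w) * (w - wm) * z"
      unfolding z_def cmod_power2 by (simp add: power2_eq_square algebra_simps)
    finally show ?thesis using pos by (simp add: field_simps)
  qed
  have zxy: "z \<le> cmod x * cmod y"
    unfolding z_def using complex_Re_le_cmod[of "x * cnj y"] by (simp add: norm_mult)
  have cross: "(wp * wm / w - w) * z \<le> o0 / 2 * (wp * (cmod x)\<^sup>2 + wm * (cmod y)\<^sup>2)"
  proof -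
    have "(wp * wm / w - w) * z \<le> (wp * wm / w - w) * (cmod x * cmod y)"
      using weight_cross(2)[of K "j $ k0"] K zxy
      by (intro mult_left_mono) (simp_all add: wp_def wm_def w_def W_shift, simp add: W_def)
    also have "\<dots> \<le> o0 / 2 * (wp * (cmod x)\<^sup>2 + wm * (cmod y)\<^sup>2)"
      using weight_cross(1)[of K "j $ k0"] K
      by (simp add: wp_def wm_def w_def W_shift o0_def) (simp add: W_def)
    finally show ?thesis .
  qed
  have curv: "((om + op) / 2 + (K / 2 - 1)) * w \<le> (wp + wm - w\<^sup>2 / wm - w\<^sup>2 / wp) / 2"
    using weight_curvature[OF K, of "j $ k0"]
    by (simp add: wp_def wm_def w_def W_shift om_def op_def) (simp add: W_def)
  \<comment> \<open>The diagonal coefficient pays for the squares that \<open>A\<close> and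
    \<open>B\<close> bring back to \<open>j\<close>, and what is left is the quantity of
    \<open>weight_curvature\<close>. In \<open>D2\<close> the square \<open>\<sigma>\<close> has
    used up the mixed term, and what is left is the defect of \<open>weight_cross\<close>.\<close>
  have D1: "wp - 2 * w + wm - (w - wm)\<^sup>2 / (2 * wm) - (wp - w)\<^sup>2 / (2 * wp) = (wp + wm - w\<^sup>2 / wm - w\<^sup>2 / wp) / 2"
    using pos by (simp add: field_simps power2_eq_square)
  have D2: "wp - 2 * w + wm - (wp - w) * (w - wm) / w = wp * wm / w - w"
    using pos by (simp add: field_simps power2_eq_square)
  have "(K / 2 - 1) * w * r \<le> ((wp - 2 * w + wm - (w - wm)\<^sup>2 / (2 * wm) - (wp - w)\<^sup>2 / (2 * wp)) - (om + op) / 2 * w) * r"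
    using curv pos(4) unfolding D1 by (intro mult_right_mono) (simp_all add: algebra_simps)
  moreover have "(wp - 2 * w + wm - (wp - w) * (w - wm) / w) * z \<le> o0 / 2 * (wp * (cmod x)\<^sup>2 + wm * (cmod y)\<^sup>2)"
    using cross unfolding D2 .
  moreover have "2 * (cmod (\<sigma> j))\<^sup>2 / w = (wp - w)\<^sup>2 / (2 * w) * (cmod x)\<^sup>2 + (w - wm)\<^sup>2 / (2 * w) * (cmod y)\<^sup>2 - (wp - w) * (w - wm) / w * z"
    unfolding sq using pos by (simp add: field_simps)
  \<comment> \<open>All quotients are abstracted into variables, so that the combination of the
    three facts is polynomial algebra.\<close>
  moreover have "S + (K / 2 - 1) * w * r + ((P1 + om / 2 * w) * r - (P3 + o0 / 2 * wp) * X
        + (P2 + op / 2 * w) * r - (P4 + o0 / 2 * wm) * Y) \<le> (wp - 2 * w + wm) * (r - z)"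
    if "(K / 2 - 1) * w * r \<le> (wp - 2 * w + wm - P1 - P2 - (om + op) / 2 * w) * r"
      "(wp - 2 * w + wm - P5) * z \<le> o0 / 2 * (wp * X + wm * Y)" "S = P3 * X + P4 * Y - P5 * z"
    for S P1 P2 P3 P4 P5 X Y :: real
    using that by (simp add: algebra_simps add_divide_distrib)
  ultimately have "2 * (cmod (\<sigma> j))\<^sup>2 / w + (K / 2 - 1) * w * r + (A (j - e) - A j + B (j + e) - B j)
      \<le> (wp - 2 * w + wm) * (r - z)"
    unfolding AB by blast
  then show ?thesis
    by (simp add: w_def wp_def wm_def r_def z_def x_def y_def)
qed


section \<open>Contributions of the single lattice directions to the rate\<close>

definition D :: "'d \<Rightarrow> int ^ 'd \<Rightarrow> real" where
  "D k j = c j * Re ((v (j + e + axis k 1) - 2 * v (j + e) + v (j + e - axis k 1)) * cnj (v j)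
     - v (j + e) * cnj (v (j + axis k 1) - 2 * v j + v (j - axis k 1)))"

definition H :: "'d \<Rightarrow> int ^ 'd \<Rightarrow> real" where
  "H k j = c j * Re (v (j + e) * cnj (v (j - axis k 1)) - v (j + e - axis k 1) * cnj (v j))"

lemma rate_eq:
  "rate j = (\<Sum>k\<in>UNIV. D k j) + c j * Re ((q (j + e) - cnj (q j)) * (v (j + e) * cnj (v j)))"
  unfolding rate_def D_def discrete_laplacian_def
  by (simp add: sum_distrib_left sum_distrib_right sum_subtractf distrib_left Re_sum flip: sum_subtractf)

text \<open>The weight, hence \<open>c\<close>, is constant along the direction \<open>k\<close>, so
  there is no commutator with the second difference in that direction and only a boundary term
  survives.\<close>

lemma D_transversal:
  assumes "k \<noteq> k0"
  shows "D k j = H k (j + axis k 1) - H k j"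
proof -
  have "j + axis k 1 + e = j + e + axis k 1" "j + axis k 1 + e - axis k 1 = j + e"
    by (simp_all add: algebra_simps)
  then show ?thesis
    unfolding D_def H_def c_axis[OF assms] by (simp add: algebra_simps)
qed

text \<open>After the shift in \<open>h\<close> the two potential terms combine into
  \<open>- 2 * Re (\<sigma> j * cnj (q j * v j))\<close>. Half of the square
  \<open>2 |\<sigma>|^2 / W\<close> from \<open>local_estimate\<close> absorbs it at the price of
  \<open>M^2 W |v|^2\<close>, which is why \<open>M\<^sup>2\<close> is subtracted in
  \<open>\<kappa>\<close>; the other half is kept to control the flux.\<close>

lemma longitudinal_estimate:
  "(cmod (\<sigma> j))\<^sup>2 / W j + \<kappa> * (W j * (cmod (v j))\<^sup>2) + (h (j + e) - h j)
     \<le> D k0 j + c j * Re ((q (j + e) - cnj (q j)) * (v (j + e) * cnj (v j)))"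
proof -
  define x where "x = v (j + e)"
  define y where "y = v (j - e)"
  define p where "p = q j"
  define Q where "Q = Re (q (j + e) * x * cnj (v j))"
  define z where "z = Re (x * cnj y)"
  define z' where "z' = Re (v (j + e + e) * cnj (v j))"
  have Dk: "D k0 j = c j * ((cmod (v j))\<^sup>2 - (cmod x)\<^sup>2 + z' - z)"
    unfolding D_def e_def[symmetric] x_def y_def z_def z'_def cmod_power2
    by (simp add: power2_eq_square algebra_simps)
  have pot: "Re ((q (j + e) - cnj p) * (x * cnj (v j))) = Q - Re (cnj p * x * cnj (v j))"
    by (simp add: Q_def algebra_simps)
  have hj: "h j = c (j - e) * (z - (cmod (v j))\<^sup>2 + Re (p * v j * cnj y)) - A (j - e) + B j"
    by (simp add: h_def z_def x_def y_def p_def)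
  have hje: "h (j + e) = c j * (z' - (cmod x)\<^sup>2 + Q) - A j + B (j + e)"
    by (simp add: h_def z'_def x_def Q_def)
  have \<sigma>: "- 2 * Re (\<sigma> j * cnj (p * v j)) = c (j - e) * Re (p * v j * cnj y) - c j * Re (cnj p * x * cnj (v j))"
  proof -
    have "2 * \<sigma> j = of_real (c j) * x - of_real (c (j - e)) * y" by (simp add: \<sigma>_def x_def y_def)
    moreover have "2 * Re (\<sigma> j * cnj (p * v j)) = Re (2 * \<sigma> j * cnj (p * v j))" by simp
    ultimately have "2 * Re (\<sigma> j * cnj (p * v j)) = Re ((of_real (c j) * x - of_real (c (j - e)) * y) * cnj (p * v j))"
      by (simp only:)
    then show ?thesis by (simp add: algebra_simps)
  qed
  have "2 * Re (\<sigma> j * cnj (p * v j)) \<le> (cmod (\<sigma> j))\<^sup>2 / W j + M\<^sup>2 * (W j * (cmod (v j))\<^sup>2)"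
  proof -
    have "Re (\<sigma> j * cnj (p * v j)) \<le> cmod (\<sigma> j) * (cmod p * cmod (v j))"
      using complex_Re_le_cmod[of "\<sigma> j * cnj (p * v j)"] by (simp add: norm_mult)
    also have "\<dots> \<le> cmod (\<sigma> j) * (M * cmod (v j))"
      using q[of j] by (intro mult_left_mono mult_right_mono) (auto simp: p_def)
    finally have 1: "Re (\<sigma> j * cnj (p * v j)) \<le> cmod (\<sigma> j) * (M * cmod (v j))" .
    have "2 * (cmod (\<sigma> j) * (M * cmod (v j))) * W j \<le> (cmod (\<sigma> j))\<^sup>2 + (M * (W j * cmod (v j)))\<^sup>2"
      using sum_squares_bound[of "cmod (\<sigma> j)" "M * (W j * cmod (v j))"] by (simp add: mult_ac)
    then have "2 * (cmod (\<sigma> j) * (M * cmod (v j))) \<le> ((cmod (\<sigma> j))\<^sup>2 + (M * (W j * cmod (v j)))\<^sup>2) / W j"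
      using W_pos[of j] by (simp add: pos_le_divide_eq)
    also have "\<dots> = (cmod (\<sigma> j))\<^sup>2 / W j + M\<^sup>2 * (W j * (cmod (v j))\<^sup>2)"
      using W_pos[of j] by (simp add: add_divide_distrib power2_eq_square)
    finally show ?thesis using 1 by linarith
  qed
  then have low: "- ((cmod (\<sigma> j))\<^sup>2 / W j) - M\<^sup>2 * (W j * (cmod (v j))\<^sup>2)
     \<le> c (j - e) * Re (p * v j * cnj y) - c j * Re (cnj p * x * cnj (v j))"
    using \<sigma> by linarith
  have loc: "2 * (cmod (\<sigma> j))\<^sup>2 / W j + (K / 2 - 1) * W j * (cmod (v j))\<^sup>2
     + (A (j - e) - A j + B (j + e) - B j) \<le> (c j - c (j - e)) * ((cmod (v j))\<^sup>2 - z)"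
    using local_estimate[of j] by (simp add: c_def z_def x_def y_def algebra_simps)
  have alg: "S + (k - m) * (w * r) + ((c1 * (z1 - xx + Q1) - A1 + B2) - (c2 * (z0 - r + P2) - A2 + B1))
      \<le> c1 * (r - xx + z1 - z0) + c1 * (Q1 - P1)"
    if "- S - m * (w * r) \<le> c2 * P2 - c1 * P1"
      "2 * S + k * w * r + (A2 - A1 + B2 - B1) \<le> (c1 - c2) * (r - z0)"
    for S k m w r c1 c2 z0 z1 xx Q1 A1 A2 B1 B2 P1 P2 :: real
    using that by (simp add: algebra_simps)
  show ?thesis
    unfolding Dk hj hje \<kappa>_def x_def[symmetric] p_def[symmetric] pot
    by (rule alg[OF low]) (use loc in simp)
qed

definition Hk :: "'d \<Rightarrow> int ^ 'd \<Rightarrow> real" where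
  "Hk k = (if k = k0 then h else H k)"

lemma rate_lower:
  "(cmod (\<sigma> j))\<^sup>2 / W j + \<kappa> * (W j * (cmod (v j))\<^sup>2) + (\<Sum>k\<in>UNIV. Hk k (j + axis k 1) - Hk k j) \<le> rate j"
proof -
  have "(\<Sum>k\<in>UNIV. Hk k (j + axis k 1) - Hk k j) = (h (j + e) - h j) + (\<Sum>k\<in>UNIV - {k0}. Hk k (j + axis k 1) - Hk k j)"
    by (subst sum.remove[of _ k0]) (auto simp: Hk_def e_def)
  also have "(\<Sum>k\<in>UNIV - {k0}. Hk k (j + axis k 1) - Hk k j) = (\<Sum>k\<in>UNIV - {k0}. D k j)"
    by (rule sum.cong) (auto simp: Hk_def D_transversal)
  finally have 1: "(\<Sum>k\<in>UNIV. Hk k (j + axis k 1) - Hk k j) = (h (j + e) - h j) + (\<Sum>k\<in>UNIV - {k0}. D k j)" .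
  have 2: "(\<Sum>k\<in>UNIV. D k j) = D k0 j + (\<Sum>k\<in>UNIV - {k0}. D k j)"
    by (rule sum.remove) auto
  show ?thesis
    unfolding rate_eq 1 2 using longitudinal_estimate[of j] by linarith
qed

section \<open>Absolute convergence of the sums over the lattice\<close>

lemma c_dom:
  assumes "l1 a \<le> 2" "l1 b \<le> 2"
  shows "\<bar>c j\<bar> * (cmod (v (j + a)) * cmod (v (j + b))) \<le> 2 * T j"
    and "\<bar>c (j - e)\<bar> * (cmod (v (j + a)) * cmod (v (j + b))) \<le> 2 * T j"
proof -
  let ?p = "cmod (v (j + a)) * cmod (v (j + b))"
  have d: "W (j + e) * ?p \<le> T j" "W j * ?p \<le> T j" "W (j - e) * ?p \<le> T j"
    using dom[of 1 a b j] dom[of 0 a b j] dom[of "-1" a b j] assms by (simp_all add: W_shift) (simp add: W_def)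
  have "\<bar>c j\<bar> \<le> W (j + e) + W j" "\<bar>c (j - e)\<bar> \<le> W j + W (j - e)"
    using W_pos[of "j + e"] W_pos[of j] W_pos[of "j - e"] by (auto simp: c_def)
  then have "\<bar>c j\<bar> * ?p \<le> (W (j + e) + W j) * ?p" "\<bar>c (j - e)\<bar> * ?p \<le> (W j + W (j - e)) * ?p"
    by (auto intro!: mult_right_mono)
  with d show "\<bar>c j\<bar> * ?p \<le> 2 * T j" "\<bar>c (j - e)\<bar> * ?p \<le> 2 * T j"
    by (simp_all only: distrib_right)
qed

lemma c_dom_Re:
  assumes "l1 a \<le> 2" "l1 b \<le> 2"
  shows "\<bar>c j * Re (v (j + a) * cnj (v (j + b)))\<bar> \<le> 2 * T j"
    and "\<bar>c (j - e) * Re (v (j + a) * cnj (v (j + b)))\<bar> \<le> 2 * T j"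
    and "\<bar>c j * Im (v (j + a) * cnj (v (j + b)))\<bar> \<le> 2 * T j"
proof -
  have "\<bar>Re (v (j + a) * cnj (v (j + b)))\<bar> \<le> cmod (v (j + a)) * cmod (v (j + b))"
    "\<bar>Im (v (j + a) * cnj (v (j + b)))\<bar> \<le> cmod (v (j + a)) * cmod (v (j + b))"
    using abs_Re_le_cmod[of "v (j + a) * cnj (v (j + b))"] abs_Im_le_cmod[of "v (j + a) * cnj (v (j + b))"]
    by (simp_all add: norm_mult)
  then show "\<bar>c j * Re (v (j + a) * cnj (v (j + b)))\<bar> \<le> 2 * T j"
    "\<bar>c (j - e) * Re (v (j + a) * cnj (v (j + b)))\<bar> \<le> 2 * T j"
    "\<bar>c j * Im (v (j + a) * cnj (v (j + b)))\<bar> \<le> 2 * T j"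
    unfolding abs_mult by (meson abs_ge_zero c_dom[OF assms] mult_left_mono order_trans)+
qed

lemma flux_bound: "\<bar>flux j\<bar> \<le> 2 * T j"
  using c_dom_Re(3)[of e 0 j] by (simp add: flux_def l1_e)

lemma H_bound: "\<bar>H k j\<bar> \<le> 4 * T j"
proof -
  have "l1 (e - axis k 1) \<le> 2"
    using l1_triangle[of e "- axis k 1"] by (simp add: l1_e)
  then have "\<bar>c j * Re (v (j + e) * cnj (v (j - axis k 1)))\<bar> \<le> 2 * T j"
    "\<bar>c j * Re (v (j + e - axis k 1) * cnj (v j))\<bar> \<le> 2 * T j"
    using c_dom_Re(1)[of e "- axis k 1" j] c_dom_Re(1)[of "e - axis k 1" 0 j]
    by (simp_all add: l1_e add_diff_eq)
  moreover have "H k j = c j * Re (v (j + e) * cnj (v (j - axis k 1))) - c j * Re (v (j + e - axis k 1) * cnj (v j))"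
    by (simp add: H_def right_diff_distrib)
  ultimately show ?thesis by linarith
qed

lemma rate_bound: "\<bar>rate j\<bar> \<le> (16 * real CARD('d) + 4 * M) * T j"
proof -
  have D: "\<bar>D k j\<bar> \<le> 16 * T j" for k
  proof -
    let ?a = "axis k 1 :: int ^ 'd"
    have l: "l1 (e + ?a) \<le> 2" "l1 (e - ?a) \<le> 2"
      using l1_triangle[of e ?a] l1_triangle[of e "- ?a"] by (simp_all add: l1_e)
    have 1: "\<bar>c j * Re (v (j + e + ?a) * cnj (v j))\<bar> \<le> 2 * T j"
      "\<bar>c j * Re (v (j + e) * cnj (v j))\<bar> \<le> 2 * T j"
      "\<bar>c j * Re (v (j + e - ?a) * cnj (v j))\<bar> \<le> 2 * T j"
      "\<bar>c j * Re (v (j + e) * cnj (v (j + ?a)))\<bar> \<le> 2 * T j"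
      "\<bar>c j * Re (v (j + e) * cnj (v (j - ?a)))\<bar> \<le> 2 * T j"
      using c_dom_Re(1)[OF l(1), of 0 j] c_dom_Re(1)[OF l(2), of 0 j] c_dom_Re(1)[of e 0 j]
        c_dom_Re(1)[of e ?a j] c_dom_Re(1)[of e "- ?a" j]
      by (simp_all add: l1_e add_diff_eq flip: add.assoc)
    have "D k j = c j * Re (v (j + e + ?a) * cnj (v j)) + c j * Re (v (j + e - ?a) * cnj (v j))
        - c j * Re (v (j + e) * cnj (v (j + ?a))) - c j * Re (v (j + e) * cnj (v (j - ?a)))"
      by (simp add: D_def algebra_simps)
    then show ?thesis using 1 T_nonneg[of j] by linarith
  qed
  have "cmod (q (j + e) - cnj (q j)) \<le> 2 * M"
    using q[of j] q[of "j + e"] norm_triangle_ineq4[of "q (j + e)" "cnj (q j)"] by simp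
  then have "\<bar>Re ((q (j + e) - cnj (q j)) * (v (j + e) * cnj (v j)))\<bar> \<le> 2 * M * (cmod (v (j + e)) * cmod (v (j + 0)))"
    using abs_Re_le_cmod[of "(q (j + e) - cnj (q j)) * (v (j + e) * cnj (v j))"]
    by (simp add: norm_mult) (smt (verit) mult_right_mono norm_ge_zero mult_nonneg_nonneg)
  then have "\<bar>c j * Re ((q (j + e) - cnj (q j)) * (v (j + e) * cnj (v j)))\<bar>
      \<le> \<bar>c j\<bar> * (2 * M * (cmod (v (j + e)) * cmod (v (j + 0))))"
    unfolding abs_mult by (intro mult_left_mono) auto
  also have "\<dots> = 2 * M * (\<bar>c j\<bar> * (cmod (v (j + e)) * cmod (v (j + 0))))" by simp
  also have "\<dots> \<le> 2 * M * (2 * T j)"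
    using M_nonneg by (intro mult_left_mono c_dom) (auto simp: l1_e)
  finally have 2: "\<bar>c j * Re ((q (j + e) - cnj (q j)) * (v (j + e) * cnj (v j)))\<bar> \<le> 4 * M * T j" by simp
  have "\<bar>\<Sum>k\<in>UNIV. D k j\<bar> \<le> (\<Sum>k::'d\<in>UNIV. 16 * T j)"
    by (rule order_trans[OF sum_abs]) (intro sum_mono D)
  then have "\<bar>\<Sum>k\<in>UNIV. D k j\<bar> \<le> 16 * real CARD('d) * T j" by simp
  then show ?thesis unfolding rate_eq using 2 by (simp add: distrib_right)
qed

text \<open>The quotients \<open>c^2 / W\<close> in \<open>A\<close> and \<open>B\<close> are the
  only terms to which \<open>dom\<close> does not apply directly. Log-convexity of the weight bounds
  them by weights at neighbouring sites; for \<open>B\<close> this reaches \<open>j - e - e\<close>,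
  hence the shift by 2 allowed in \<open>dom\<close>.\<close>

lemma h_bound: "\<bar>h j\<bar> \<le> (6 + 2 * M + K) * T j"
proof -
  have l: "l1 (0::int ^ 'd) \<le> 2" "l1 e \<le> 2" "l1 (- e) \<le> 2" by (simp_all add: l1_e)
  have 1: "\<bar>c (j - e) * Re (v (j + e) * cnj (v (j - e)))\<bar> \<le> 2 * T j"
    using c_dom_Re(2)[OF l(2,3), of j] by simp
  have 2: "\<bar>c (j - e) * (cmod (v j))\<^sup>2\<bar> \<le> 2 * T j"
    using c_dom(2)[OF l(1,1), of j] by (simp add: abs_mult power2_eq_square)
  have 3: "\<bar>c (j - e) * Re (q j * v j * cnj (v (j - e)))\<bar> \<le> 2 * M * T j"
  proof -
    have "\<bar>Re (q j * v j * cnj (v (j - e)))\<bar> \<le> cmod (q j) * (cmod (v j) * cmod (v (j - e)))"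
      using abs_Re_le_cmod[of "q j * v j * cnj (v (j - e))"] by (simp add: norm_mult)
    also have "\<dots> \<le> M * (cmod (v j) * cmod (v (j - e)))" by (intro mult_right_mono q) auto
    finally have "\<bar>c (j - e) * Re (q j * v j * cnj (v (j - e)))\<bar> \<le> \<bar>c (j - e)\<bar> * (M * (cmod (v j) * cmod (v (j - e))))"
      unfolding abs_mult by (intro mult_left_mono) auto
    also have "\<dots> = M * (\<bar>c (j - e)\<bar> * (cmod (v j) * cmod (v (j - e))))" by simp
    also have "\<dots> \<le> M * (2 * T j)"
      using M_nonneg c_dom(2)[OF l(1,3), of j] by (intro mult_left_mono) auto
    finally show ?thesis by simp
  qed
  have csq: "(c (j - e))\<^sup>2 \<le> (W j)\<^sup>2 + (W (j - e))\<^sup>2"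
    using W_pos[of j] W_pos[of "j - e"] by (simp add: c_def power2_diff)
  have o: "0 \<le> cross_coeff K i" "cross_coeff K i \<le> K" for i
    using K by (auto simp: cross_coeff_def)
  have d: "W (j + e) * (cmod (v j))\<^sup>2 \<le> T j" "W (j - e) * (cmod (v j))\<^sup>2 \<le> T j" "W j * (cmod (v j))\<^sup>2 \<le> T j"
    "W j * (cmod (v (j - e)))\<^sup>2 \<le> T j" "W (j - e) * (cmod (v (j - e)))\<^sup>2 \<le> T j" "W (j - e - e) * (cmod (v (j - e)))\<^sup>2 \<le> T j"
    using dom[OF _ l(1,1), of 1 j] dom[OF _ l(1,1), of "-1" j] dom[OF _ l(1,1), of 0 j]
      dom[OF _ l(3,3), of 0 j] dom[OF _ l(3,3), of "-1" j] dom[OF _ l(3,3), of "-2" j]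
    unfolding W_shift power2_eq_square by simp_all (simp_all add: W_def)
  have 4: "\<bar>A (j - e)\<bar> \<le> (1 + K / 2) * T j"
  proof -
    have "(c (j - e))\<^sup>2 / W (j - e) \<le> W (j + e) + W (j - e)"
      using csq W_log_convex[of j] W_pos[of "j - e"] by (simp add: pos_divide_le_eq power2_eq_square algebra_simps)
    then have "(c (j - e))\<^sup>2 / (2 * W (j - e)) + cross_coeff K ((j - e) $ k0) / 2 * W j \<le> (W (j + e) + W (j - e)) / 2 + K / 2 * W j"
      using o W_pos[of j] by (intro add_mono mult_right_mono) auto
    then have "A (j - e) \<le> ((W (j + e) + W (j - e)) / 2 + K / 2 * W j) * (cmod (v j))\<^sup>2"
      unfolding A_def diff_add_cancel by (intro mult_right_mono) auto
    also have "\<dots> = (W (j + e) * (cmod (v j))\<^sup>2 + W (j - e) * (cmod (v j))\<^sup>2) / 2 + K / 2 * (W j * (cmod (v j))\<^sup>2)"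
      by (simp add: algebra_simps)
    also have "\<dots> \<le> (T j + T j) / 2 + K / 2 * T j"
      using d K by (intro add_mono divide_right_mono mult_left_mono) auto
    finally have "A (j - e) \<le> (1 + K / 2) * T j" by (simp add: distrib_right)
    moreover have "A (j - e) \<ge> 0"
      unfolding A_def diff_add_cancel using W_pos[of j] W_pos[of "j - e"] o
      by (intro mult_nonneg_nonneg add_nonneg_nonneg) auto
    ultimately show ?thesis by simp
  qed
  have 5: "\<bar>B j\<bar> \<le> (1 + K / 2) * T j"
  proof -
    have "(c (j - e))\<^sup>2 / W j \<le> W j + W (j - e - e)"
      using csq W_log_convex[of "j - e"] W_pos[of j] by (simp add: pos_divide_le_eq power2_eq_square algebra_simps)
    then have "(c (j - e))\<^sup>2 / (2 * W j) + cross_coeff K (j $ k0) / 2 * W (j - e) \<le> (W j + W (j - e - e)) / 2 + K / 2 * W (j - e)"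
      using o W_pos[of "j - e"] by (intro add_mono mult_right_mono) auto
    then have "B j \<le> ((W j + W (j - e - e)) / 2 + K / 2 * W (j - e)) * (cmod (v (j - e)))\<^sup>2"
      unfolding B_def by (intro mult_right_mono) auto
    also have "\<dots> = (W j * (cmod (v (j - e)))\<^sup>2 + W (j - e - e) * (cmod (v (j - e)))\<^sup>2) / 2 + K / 2 * (W (j - e) * (cmod (v (j - e)))\<^sup>2)"
      by (simp add: algebra_simps)
    also have "\<dots> \<le> (T j + T j) / 2 + K / 2 * T j"
      using d K by (intro add_mono divide_right_mono mult_left_mono) auto
    finally have "B j \<le> (1 + K / 2) * T j" by (simp add: distrib_right)
    moreover have "B j \<ge> 0"
      unfolding B_def using W_pos[of j] W_pos[of "j - e"] o
      by (intro mult_nonneg_nonneg add_nonneg_nonneg) auto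
    ultimately show ?thesis by simp
  qed
  have "h j = c (j - e) * Re (v (j + e) * cnj (v (j - e))) - c (j - e) * (cmod (v j))\<^sup>2
      + c (j - e) * Re (q j * v j * cnj (v (j - e))) - A (j - e) + B j"
    by (simp only: h_def ring_distribs)
  then have "\<bar>h j\<bar> \<le> 2 * T j + 2 * T j + 2 * M * T j + (1 + K / 2) * T j + (1 + K / 2) * T j"
    using 1 2 3 4 5 by linarith
  also have "\<dots> = (6 + 2 * M + K) * T j" by (simp add: algebra_simps)
  finally show ?thesis .
qed

lemma summable: "rate summable_on UNIV" "flux summable_on UNIV" "Hk k summable_on UNIV"
  using summable_on_dominated[OF T rate_bound] summable_on_dominated[OF T flux_bound]
    summable_on_dominated[OF T h_bound] summable_on_dominated[OF T H_bound[of k]]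
  by (simp_all add: Hk_def)

section \<open>Lower bounds for the total rate\<close>

theorem total_rate_ge_component:
  assumes "\<kappa> \<ge> 0"
  shows "\<kappa> * (cmod (v j))\<^sup>2 \<le> infsum rate UNIV"
proof -
  let ?g = "\<lambda>j. \<kappa> * (W j * (cmod (v j))\<^sup>2)"
  have "W i * (cmod (v i))\<^sup>2 \<le> T i" for i
    using dom[of 0 0 0 i] by (simp add: W_def power2_eq_square l1_e)
  then have s: "?g summable_on UNIV"
    using W_pos \<open>\<kappa> \<ge> 0\<close>
    by (intro summable_on_dominated[OF T, where C = \<kappa>])
       (simp add: abs_mult less_imp_le abs_of_pos mult_left_mono)
  have nn: "0 \<le> ?g i" for i
    using W_pos[of i] assms by (intro mult_nonneg_nonneg) auto
  have "\<kappa> * (cmod (v j))\<^sup>2 \<le> ?g j"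
    using W_ge_1[of j] assms mult_right_mono[of 1 "W j" "(cmod (v j))\<^sup>2"] by (intro mult_left_mono) auto
  also have "\<dots> \<le> infsum ?g UNIV"
    using finite_sum_le_infsum[OF s, of "{j}"] nn by simp
  also have "\<dots> \<le> infsum rate UNIV"
  proof (rule infsum_mono_mod_shifts[OF summable(1) s])
    show "?g j + (\<Sum>k\<in>UNIV. Hk k (j + axis k 1) - Hk k j) \<le> rate j" for j
    proof -
      have "0 \<le> (cmod (\<sigma> j))\<^sup>2 / W j" using W_pos[of j] by simp
      then show ?thesis using rate_lower[of j] by linarith
    qed
  qed (auto intro: summable)
  finally show ?thesis .
qed

text \<open>The sum \<open>flux j + flux (j - e)\<close> equals
  \<open>2 * Im (\<sigma> j * cnj (v j))\<close>, so the inequality between arithmetic and geometric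
  mean bounds it by the two positive terms of \<open>rate_lower\<close>. The sign \<open>s\<close>
  yields the absolute value of the total flux.\<close>

theorem total_rate_ge_flux:
  assumes "\<kappa> \<ge> 0"
  shows "2 * sqrt \<kappa> * \<bar>infsum flux UNIV\<bar> \<le> infsum rate UNIV"
proof -
  have main: "infsum (\<lambda>j. s * (2 * sqrt \<kappa>) * flux j) UNIV \<le> infsum rate UNIV" if s: "\<bar>s\<bar> = 1" for s :: real
  proof -
    \<comment> \<open>The increment of \<open>g\<close> replaces \<open>2 * flux j\<close> by
      \<open>flux j + flux (j - e)\<close>, up to the factor
      \<open>s * sqrt \<kappa>\<close>.\<close>
    define g where "g j = s * sqrt \<kappa> * flux (j - e)" for j
    define L where "L k = (if k = k0 then (\<lambda>j. h j - g j) else H k)" for k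
    have gs: "g summable_on UNIV"
      unfolding g_def using infsum_shift(2)[of flux "- e"] summable(2)
      by (intro summable_on_cmult_right) simp
    have hs: "h summable_on UNIV" using summable(3)[of k0] by (simp add: Hk_def)
    have "(\<lambda>j. h j + - g j) summable_on UNIV"
      by (intro summable_on_add hs) (use gs in \<open>simp add: summable_on_uminus\<close>)
    then have Ls: "L k summable_on UNIV" for k
      using summable(3)[of k] by (auto simp: L_def Hk_def)
    show ?thesis
    proof (rule infsum_mono_mod_shifts[OF summable(1) _ _ Ls])
      show "(\<lambda>j. s * (2 * sqrt \<kappa>) * flux j) summable_on UNIV"
        by (intro summable_on_cmult_right summable)
      show "s * (2 * sqrt \<kappa>) * flux j + (\<Sum>k\<in>UNIV. L k (j + axis k 1) - L k j) \<le> rate j" for j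
      proof -
        have "(\<Sum>k\<in>UNIV. L k (j + axis k 1) - L k j) = (h (j + e) - g (j + e) - (h j - g j)) + (\<Sum>k\<in>UNIV - {k0}. L k (j + axis k 1) - L k j)"
          by (subst sum.remove[of _ k0]) (auto simp: L_def e_def)
        also have "(\<Sum>k\<in>UNIV - {k0}. L k (j + axis k 1) - L k j) = (\<Sum>k\<in>UNIV - {k0}. Hk k (j + axis k 1) - Hk k j)"
          by (rule sum.cong) (auto simp: L_def Hk_def)
        also have "(h (j + e) - g (j + e) - (h j - g j)) + \<dots> = (\<Sum>k\<in>UNIV. Hk k (j + axis k 1) - Hk k j) - (g (j + e) - g j)"
          by (subst (2) sum.remove[of _ k0]) (auto simp: Hk_def e_def)
        finally have 1: "(\<Sum>k\<in>UNIV. L k (j + axis k 1) - L k j) = (\<Sum>k\<in>UNIV. Hk k (j + axis k 1) - Hk k j) - (g (j + e) - g j)" .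
        have "flux j + flux (j - e) = 2 * Im (\<sigma> j * cnj (v j))"
          by (simp add: flux_def \<sigma>_def algebra_simps)
        moreover have "s * (2 * sqrt \<kappa>) * flux j - (g (j + e) - g j) = s * sqrt \<kappa> * (flux j + flux (j - e))"
          by (simp add: g_def algebra_simps)
        ultimately have "s * (2 * sqrt \<kappa>) * flux j - (g (j + e) - g j) = s * (2 * sqrt \<kappa>) * Im (\<sigma> j * cnj (v j))"
          by (simp only: mult_ac)
        also have "\<dots> \<le> 2 * sqrt \<kappa> * \<bar>Im (\<sigma> j * cnj (v j))\<bar>"
          using s assms abs_ge_self[of "s * (2 * sqrt \<kappa>) * Im (\<sigma> j * cnj (v j))"] by (simp add: abs_mult)
        also have "\<dots> \<le> 2 * sqrt \<kappa> * (cmod (\<sigma> j) * cmod (v j))"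
          using abs_Im_le_cmod[of "\<sigma> j * cnj (v j)"] assms by (intro mult_left_mono) (auto simp: norm_mult)
        also have "\<dots> \<le> (cmod (\<sigma> j))\<^sup>2 / W j + \<kappa> * (W j * (cmod (v j))\<^sup>2)"
        proof -
          have "2 * sqrt \<kappa> * (cmod (\<sigma> j) * cmod (v j)) * W j \<le> (cmod (\<sigma> j))\<^sup>2 + (sqrt \<kappa> * (W j * cmod (v j)))\<^sup>2"
            using sum_squares_bound[of "cmod (\<sigma> j)" "sqrt \<kappa> * (W j * cmod (v j))"] by (simp add: mult_ac)
          also have "(sqrt \<kappa> * (W j * cmod (v j)))\<^sup>2 = \<kappa> * (W j * (cmod (v j))\<^sup>2) * W j"
            using assms by (simp add: power_mult_distrib) (simp add: power2_eq_square)
          finally have "2 * sqrt \<kappa> * (cmod (\<sigma> j) * cmod (v j)) * W j \<le> ((cmod (\<sigma> j))\<^sup>2 / W j + \<kappa> * (W j * (cmod (v j))\<^sup>2)) * W j"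
            using W_pos[of j] by (simp add: distrib_right)
          then show ?thesis using W_pos[of j] by (simp only: mult_le_cancel_right_pos)
        qed
        finally show ?thesis using rate_lower[of j] unfolding 1 by linarith
      qed
    qed auto
  qed
  have eq: "infsum (\<lambda>j. s * (2 * sqrt \<kappa>) * flux j) UNIV = s * (2 * sqrt \<kappa>) * infsum flux UNIV" for s
    by (rule infsum_cmult_right') 
  show ?thesis
    using main[of 1] main[of "-1"] unfolding eq by (cases "infsum flux UNIV \<ge> 0") auto
qed

end

section \<open>Superexponential decay beats the weight\<close>

text \<open>A finite set lies in a box, over which the sum factorises into one-dimensional sums.
  Each of these is at most 4: two half-lines of total 2, with the origin counted twice.\<close>

lemma geometric_l1_summable: "(\<lambda>j::int ^ 'd::finite. (1 / 2 :: real) ^ l1 j) summable_on UNIV"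
proof (rule nonneg_bounded_partial_sums_imp_summable_on)
  have one_dim: "(\<Sum>i\<in>{- int n..int n}. (1 / 2 :: real) ^ nat \<bar>i\<bar>) \<le> 4" for n
  proof -
    have geo: "(\<Sum>m\<le>n. (1 / 2 :: real) ^ m) \<le> 2"
      using sum_gp_basic[of "1 / 2 :: real" n] by simp
    have sub: "{- int n..int n} \<subseteq> int ` {..n} \<union> (\<lambda>m. - int m) ` {..n}"
    proof
      fix i assume "i \<in> {- int n..int n}"
      then have "i = int (nat \<bar>i\<bar>) \<or> i = - int (nat \<bar>i\<bar>)" "nat \<bar>i\<bar> \<in> {..n}" by auto
      then show "i \<in> int ` {..n} \<union> (\<lambda>m. - int m) ` {..n}" by blast
    qed
    have "(\<Sum>i\<in>{- int n..int n}. (1 / 2 :: real) ^ nat \<bar>i\<bar>)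
        \<le> (\<Sum>i\<in>int ` {..n} \<union> (\<lambda>m. - int m) ` {..n}. (1 / 2) ^ nat \<bar>i\<bar>)"
      by (intro sum_mono2 sub) auto
    also have "\<dots> \<le> (\<Sum>i\<in>int ` {..n}. (1 / 2) ^ nat \<bar>i\<bar>) + (\<Sum>i\<in>(\<lambda>m. - int m) ` {..n}. (1 / 2) ^ nat \<bar>i\<bar>)"
      by (subst sum.union_inter[symmetric]) (auto intro!: sum_nonneg)
    also have "\<dots> = (\<Sum>m\<le>n. (1 / 2) ^ m) + (\<Sum>m\<le>n. (1 / 2) ^ m)"
      by (subst (1 2) sum.reindex) (auto simp: inj_on_def)
    finally show ?thesis using geo by linarith
  qed
  show "\<forall>\<^sub>F X in finite_subsets_at_top UNIV. (\<Sum>j\<in>X. (1 / 2 :: real) ^ l1 (j :: int ^ 'd)) \<le> 4 ^ CARD('d)"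
  proof (rule eventually_finite_subsets_at_top_weakI)
    fix X :: "(int ^ 'd) set" assume X: "finite X"
    define n where "n = Max (insert 0 (l1 ` X))"
    have n: "l1 j \<le> n" if "j \<in> X" for j using X that by (simp add: n_def)
    let ?P = "PiE (UNIV :: 'd set) (\<lambda>_. {- int n..int n})"
    have comp: "nat \<bar>j $ k\<bar> \<le> l1 j" for j :: "int ^ 'd" and k
      unfolding l1_def by (rule member_le_sum) auto
    have inj: "inj_on vec_nth X" by (simp add: inj_on_def vec_nth_inject)
    have "(\<Sum>j\<in>X. (1 / 2 :: real) ^ l1 j) = (\<Sum>j\<in>X. \<Prod>k\<in>UNIV. (1 / 2) ^ nat \<bar>j $ k\<bar>)"
      by (simp add: l1_def power_sum)
    also have "\<dots> = (\<Sum>g\<in>vec_nth ` X. \<Prod>k\<in>UNIV. (1 / 2) ^ nat \<bar>g k\<bar>)"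
      by (simp add: sum.reindex[OF inj])
    also have "\<dots> \<le> (\<Sum>g\<in>?P. \<Prod>k\<in>UNIV. (1 / 2) ^ nat \<bar>g k\<bar>)"
    proof (rule sum_mono2)
      show "vec_nth ` X \<subseteq> ?P"
      proof (clarsimp simp: PiE_iff)
        fix j k assume "j \<in> X"
        then show "- int n \<le> j $ k \<and> j $ k \<le> int n" using n[of j] comp[of j k] by linarith
      qed
    qed (auto intro!: finite_PiE prod_nonneg)
    also have "\<dots> = (\<Prod>k\<in>(UNIV :: 'd set). \<Sum>i\<in>{- int n..int n}. (1 / 2) ^ nat \<bar>i\<bar>)"
      by (rule prod_sum_PiE[symmetric]) auto
    also have "\<dots> \<le> (\<Prod>k\<in>(UNIV :: 'd set). 4)"
      by (intro prod_mono conjI one_dim sum_nonneg) auto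
    finally show "(\<Sum>j\<in>X. (1 / 2 :: real) ^ l1 j) \<le> 4 ^ CARD('d)" by simp
  qed
qed auto

lemma prod_odd_le_fact: "(\<Prod>m<n. 2 * real m + 1) \<le> 2 ^ n * fact n"
proof (induction n)
  case (Suc n)
  have "(\<Prod>m<Suc n. 2 * real m + 1) \<le> (2 ^ n * fact n) * (2 * real (Suc n))"
    unfolding prod.lessThan_Suc using Suc by (intro mult_mono) auto
  then show ?case by (simp add: algebra_simps)
qed simp

lemma weight_le:
  assumes "K \<ge> 1" "nat \<bar>i\<bar> \<le> n"
  shows "weight K i \<le> (2 * K) ^ n * fact n"
proof -
  have "weight K i \<le> K ^ nat \<bar>i\<bar> * (2 ^ nat \<bar>i\<bar> * fact (nat \<bar>i\<bar>))"
    unfolding weight_def using prod_odd_le_fact assms by (intro mult_left_mono) auto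
  also have "\<dots> = (2 * K) ^ nat \<bar>i\<bar> * fact (nat \<bar>i\<bar>)" by (simp add: power_mult_distrib)
  also have "\<dots> \<le> (2 * K) ^ n * fact n"
    using assms by (intro mult_mono power_increasing fact_mono) auto
  finally show ?thesis .
qed

text \<open>The base \<open>n + 1\<close> is chosen to cancel against
  \<open>X^2 = 16 K (n + 1)\<close> in the product bound, and the shift by 2 accommodates weights
  two sites away.\<close>

lemma fact_add_2_le: "(fact (n + 2) :: real) \<le> (real n + 2)\<^sup>2 * (real n + 1) ^ n"
proof -
  have "(fact n :: real) \<le> real n ^ n"
    using fact_le_power[of n, where 'a = real] by simp
  also have "\<dots> \<le> (real n + 1) ^ n" by (intro power_mono) auto
  finally have 1: "(fact n :: real) \<le> (real n + 1) ^ n" .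
  have "(fact (n + 2) :: real) = ((real n + 2) * (real n + 1)) * fact n" by (simp add: algebra_simps)
  also have "\<dots> \<le> ((real n + 2) * (real n + 2)) * (real n + 1) ^ n"
    by (intro mult_mono 1) auto
  finally show ?thesis by (simp add: power2_eq_square)
qed

text \<open>The radius \<open>X = 4 sqrt (K (n + 1))\<close> makes \<open>X ^ (2 n)\<close> beat the weight \<open>(2 K) ^ n fact n\<close>
  by a factor \<open>8 ^ n\<close>.\<close>

lemma weighted_product_bound:
  fixes v :: "int ^ 'd::finite \<Rightarrow> complex"
  assumes K: "K \<ge> 1" and v: "\<And>X j. X \<ge> 1 \<Longrightarrow> cmod (v j) \<le> Y X / X ^ l1 j"
    and Y: "\<And>X. X \<ge> 1 \<Longrightarrow> Y X \<ge> 0"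
    and B: "\<And>n::nat. 1024 * K ^ 4 * (Y (4 * sqrt (K * (real n + 1))))\<^sup>2 * (real n + 2) ^ 4 / 4 ^ n \<le> B"
    and "\<bar>i\<bar> \<le> 2" "l1 a \<le> 2" "l1 b \<le> 2"
  shows "weight K (j $ k0 + i) * (cmod (v (j + a)) * cmod (v (j + b))) \<le> B * (1 / 2) ^ l1 j"
proof -
  define n where "n = l1 j"
  \<comment> \<open>With \<open>n + 1\<close> instead of \<open>n\<close> the radius is at least 1
    at the origin too.\<close>
  define X where "X = 4 * sqrt (K * (real n + 1))"
  have "K * (real n + 1) \<ge> 1 * 1" using K by (intro mult_mono) auto
  then have Kn: "K * (real n + 1) \<ge> 1" "sqrt (K * (real n + 1)) \<ge> 1" by auto
  have X: "X \<ge> 1" using Kn(2) unfolding X_def by linarith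
  have "X\<^sup>2 = 16 * (sqrt (K * (real n + 1)))\<^sup>2" unfolding X_def power_mult_distrib by simp
  also have "\<dots> = 16 * K * (real n + 1)"
    using Kn(1) by (subst real_sqrt_pow2) (linarith, simp only: mult.assoc)
  finally have X2: "X\<^sup>2 = 16 * K * (real n + 1)" .
  have div: "y / p \<le> y * q / r" if "y * r \<le> y * (q * p)" "p > 0" "r > 0" for y p q r :: real
    using that by (simp add: field_simps)
  have shift: "cmod (v (j + a)) \<le> Y X * X\<^sup>2 / X ^ n" if "l1 a \<le> 2" for a
  proof -
    have "X ^ n \<le> X ^ (l1 (j + a) + 2)"
      using l1_le_add[of j a] that X by (intro power_increasing) (auto simp: n_def)
    then have "Y X * X ^ n \<le> Y X * (X\<^sup>2 * X ^ l1 (j + a))"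
      using Y[OF X] by (intro mult_left_mono) (auto simp: power_add power2_eq_square mult_ac)
    then have "Y X / X ^ l1 (j + a) \<le> Y X * X\<^sup>2 / X ^ n"
      using div[of "Y X" "X ^ n" "X\<^sup>2" "X ^ l1 (j + a)"] X by simp
    with v[OF X, of "j + a"] show ?thesis by linarith
  qed
  have "cmod (v (j + a)) * cmod (v (j + b)) \<le> (Y X * X\<^sup>2 / X ^ n) * (Y X * X\<^sup>2 / X ^ n)"
    using assms X Y[OF X] by (intro mult_mono shift) auto
  also have "\<dots> = (Y X)\<^sup>2 * (X\<^sup>2)\<^sup>2 / (X\<^sup>2) ^ n"
    by (simp add: power2_eq_square power_mult_distrib mult_ac)
  finally have prod: "cmod (v (j + a)) * cmod (v (j + b)) \<le> (Y X)\<^sup>2 * (16 * K * (real n + 1))\<^sup>2 / (16 * K * (real n + 1)) ^ n"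
    unfolding X2 .
  have "nat \<bar>j $ k0\<bar> \<le> n" unfolding n_def l1_def by (rule member_le_sum) auto
  then have "weight K (j $ k0 + i) \<le> (2 * K) ^ (n + 2) * fact (n + 2)"
    using assms by (intro weight_le) auto
  also have "\<dots> \<le> (2 * K) ^ (n + 2) * ((real n + 2)\<^sup>2 * (real n + 1) ^ n)"
    using K by (intro mult_left_mono fact_add_2_le) auto
  finally have "weight K (j $ k0 + i) * (cmod (v (j + a)) * cmod (v (j + b)))
    \<le> ((2 * K) ^ (n + 2) * ((real n + 2)\<^sup>2 * (real n + 1) ^ n)) * ((Y X)\<^sup>2 * (16 * K * (real n + 1))\<^sup>2 / (16 * K * (real n + 1)) ^ n)"
    using prod K weight_pos[OF K, of "j $ k0 + i"] by (intro mult_mono) auto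
  also have "\<dots> = 1024 * K ^ 4 * (Y X)\<^sup>2 * ((real n + 2)\<^sup>2 * (real n + 1)\<^sup>2) / 8 ^ n"
  proof -
    have e1: "(16 * K * (real n + 1)) ^ n = 8 ^ n * ((2 * K) ^ n * (real n + 1) ^ n)"
      using power_mult_distrib[of 8 "2 * K" n] power_mult_distrib[of "8 * (2 * K)" "real n + 1" n] by simp
    have e2: "(2 * K) ^ (n + 2) = (2 * K) ^ n * (4 * K\<^sup>2)" by (simp add: power_add power2_eq_square)
    have e3: "(16 * K * (real n + 1))\<^sup>2 = 256 * K\<^sup>2 * (real n + 1)\<^sup>2" by (simp add: power_mult_distrib)
    have e4: "x * (4 * K\<^sup>2) * (p * y) * (z * (256 * K\<^sup>2 * s) / (w * (x * y))) = 1024 * K ^ 4 * z * (p * s) / w"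
      if "x \<noteq> 0" "y \<noteq> 0" for x y z p s w :: real
      using that by (simp add: power4_eq_xxxx power2_eq_square)
    show ?thesis unfolding e1 e2 e3 by (rule e4) (use K in auto)
  qed
  also have "\<dots> \<le> 1024 * K ^ 4 * (Y X)\<^sup>2 * (real n + 2) ^ 4 / 8 ^ n"
  proof -
    have "(real n + 2)\<^sup>2 * (real n + 1)\<^sup>2 \<le> (real n + 2)\<^sup>2 * (real n + 2)\<^sup>2"
      by (intro mult_left_mono power_mono) auto
    also have "\<dots> = (real n + 2) ^ 4" by (simp flip: power_add)
    finally show ?thesis using K by (intro divide_right_mono mult_left_mono) auto
  qed
  \<comment> \<open>Of the gain \<open>8 ^ n\<close>, the factor \<open>4 ^ n\<close> is spent on
    the growth of \<open>Y\<close>, and \<open>2 ^ n\<close> is kept to make the dominating family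
    summable.\<close>
  also have "\<dots> = 1024 * K ^ 4 * (Y X)\<^sup>2 * (real n + 2) ^ 4 / 4 ^ n * (1 / 2) ^ n"
    using power_mult_distrib[of "4 :: real" 2 n] by (simp add: power_divide)
  also have "\<dots> \<le> B * (1 / 2) ^ n"
    using B[of n] unfolding X_def by (intro mult_right_mono) auto
  finally show ?thesis by (simp add: n_def)
qed

lemma bounded_of_tendsto_0:
  fixes f :: "nat \<Rightarrow> real"
  assumes "f \<longlonglongrightarrow> 0"
  shows "\<exists>B\<ge>0. \<forall>n. f n \<le> B"
proof -
  from convergent_imp_Bseq[OF convergentI[OF assms]] obtain B where "B > 0" "\<And>n. norm (f n) \<le> B"
    unfolding Bseq_def by blast
  then show ?thesis by (intro exI[of _ B]) (auto intro: order_trans[OF abs_ge_self])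
qed

lemma exponential_radius_bound:
  assumes "K > 0" "c \<ge> 0"
  obtains B where "B \<ge> 0"
    "\<And>n::nat. 1024 * K ^ 4 * (A * exp (c * (4 * sqrt (K * (real n + 1)))))\<^sup>2 * (real n + 2) ^ 4 / 4 ^ n \<le> B"
proof -
  have "(\<lambda>n::nat. exp (c * (4 * sqrt (K * (real n + 1)))) ^ 2 * (real n + 2) ^ 4 / 4 ^ n) \<longlonglongrightarrow> 0"
    using assms by (cases "c = 0") (simp, real_asymp, real_asymp)
  then obtain B where B: "B \<ge> 0" "\<And>n::nat. exp (c * (4 * sqrt (K * (real n + 1)))) ^ 2 * (real n + 2) ^ 4 / 4 ^ n \<le> B"
    using bounded_of_tendsto_0 by blast
  have "1024 * K ^ 4 * (A * exp (c * (4 * sqrt (K * (real n + 1)))))\<^sup>2 * (real n + 2) ^ 4 / 4 ^ n \<le> 1024 * K ^ 4 * A\<^sup>2 * B" for n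
    using mult_left_mono[OF B(2)[of n], of "1024 * K ^ 4 * A\<^sup>2"] by (simp add: power_mult_distrib mult_ac)
  then show thesis using that[of "1024 * K ^ 4 * A\<^sup>2 * B"] B(1) by simp
qed

text \<open>Here \<open>B\<close> is chosen before \<open>K\<close>, in contrast to
  \<open>exponential_radius_bound\<close>. The logarithm of the radius is the mean of
  \<open>ln (16 * K)\<close> and \<open>ln (n + 1)\<close>, and convexity of the square separates
  the two, leaving the dependence on \<open>K\<close> explicit.\<close>

lemma gaussian_radius_bound:
  assumes "c \<ge> 0"
  obtains B where "B \<ge> 0"
    "\<And>K (n::nat). K \<ge> 1 \<Longrightarrow> 1024 * K ^ 4 * (A * exp (c * (ln (4 * sqrt (K * (real n + 1))))\<^sup>2))\<^sup>2 * (real n + 2) ^ 4 / 4 ^ n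
      \<le> B * K ^ 4 * exp (c * (ln (16 * K))\<^sup>2)"
proof -
  have "(\<lambda>n::nat. exp (c * (ln (real n + 1))\<^sup>2) * (real n + 2) ^ 4 / 4 ^ n) \<longlonglongrightarrow> 0"
    using assms by (cases "c = 0") (simp, real_asymp, real_asymp)
  then obtain B where B: "B \<ge> 0" "\<And>n::nat. exp (c * (ln (real n + 1))\<^sup>2) * (real n + 2) ^ 4 / 4 ^ n \<le> B"
    using bounded_of_tendsto_0 by blast
  have "1024 * K ^ 4 * (A * exp (c * (ln (4 * sqrt (K * (real n + 1))))\<^sup>2))\<^sup>2 * (real n + 2) ^ 4 / 4 ^ n
      \<le> 1024 * A\<^sup>2 * B * K ^ 4 * exp (c * (ln (16 * K))\<^sup>2)" if K: "K \<ge> 1" for K and n :: nat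
  proof -
    have "4 * sqrt (K * (real n + 1)) = sqrt (16 * K * (real n + 1))"
      using real_sqrt_mult[of 16 "K * (real n + 1)"] by (simp add: mult.assoc)
    then have "ln (4 * sqrt (K * (real n + 1))) = (ln (16 * K) + ln (real n + 1)) / 2"
      using K by (simp add: ln_sqrt ln_mult)
    then have "2 * (ln (4 * sqrt (K * (real n + 1))))\<^sup>2 \<le> (ln (16 * K))\<^sup>2 + (ln (real n + 1))\<^sup>2"
      using sum_squares_bound[of "ln (16 * K)" "ln (real n + 1)"]
      by (simp only: power_divide power2_sum) simp
    then have "c * (2 * (ln (4 * sqrt (K * (real n + 1))))\<^sup>2) \<le> c * ((ln (16 * K))\<^sup>2 + (ln (real n + 1))\<^sup>2)"
      using assms by (rule mult_left_mono)
    then have "(exp (c * (ln (4 * sqrt (K * (real n + 1))))\<^sup>2))\<^sup>2 \<le> exp (c * (ln (16 * K))\<^sup>2) * exp (c * (ln (real n + 1))\<^sup>2)"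
      by (simp add: power2_eq_square distrib_left flip: exp_add)
    then have "1024 * K ^ 4 * (A * exp (c * (ln (4 * sqrt (K * (real n + 1))))\<^sup>2))\<^sup>2 * (real n + 2) ^ 4 / 4 ^ n
      \<le> 1024 * K ^ 4 * (A\<^sup>2 * (exp (c * (ln (16 * K))\<^sup>2) * exp (c * (ln (real n + 1))\<^sup>2))) * (real n + 2) ^ 4 / 4 ^ n"
      unfolding power_mult_distrib[of A] by (intro divide_right_mono mult_right_mono mult_left_mono) auto
    also have "\<dots> = 1024 * K ^ 4 * A\<^sup>2 * exp (c * (ln (16 * K))\<^sup>2) * (exp (c * (ln (real n + 1))\<^sup>2) * (real n + 2) ^ 4 / 4 ^ n)"
      by simp
    also have "\<dots> \<le> 1024 * K ^ 4 * A\<^sup>2 * exp (c * (ln (16 * K))\<^sup>2) * B"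
      by (intro mult_left_mono B) auto
    finally show ?thesis by (simp add: mult_ac)
  qed
  then show thesis using that[of "1024 * A\<^sup>2 * B"] B(1) by simp
qed

section \<open>Pointwise decay of Gaussian data\<close>

lemma lattice_norm_power2: "(lattice_norm j)\<^sup>2 = (\<Sum>k\<in>UNIV. (real_of_int (j $ k))\<^sup>2)"
  by (simp add: lattice_norm_def norm_vec_def L2_set_def sum_nonneg)

text \<open>Summing \<open>ln X |j_k| <= (ln X)^2 / 2 + j_k^2 / 2\<close> over the coordinates
  compares the Gaussian with \<open>X ^ l1 j\<close>, the last term being absorbed by
  \<open>lam > 1 / 2\<close>. The radius \<open>X\<close> stays free so that it can later depend on
  the site.\<close>

lemma gaussian_decay:
  fixes f :: "int ^ 'd::finite \<Rightarrow> complex"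
  assumes "lam > 1 / 2" and s: "(\<lambda>j. exp (2 * lam * (lattice_norm j)\<^sup>2) * (cmod (f j))\<^sup>2) summable_on UNIV"
  obtains A where "A \<ge> 0" "\<And>X j. X \<ge> 1 \<Longrightarrow> cmod (f j) \<le> A * exp (real CARD('d) / 2 * (ln X)\<^sup>2) / X ^ l1 j"
proof -
  define S where "S = (\<Sum>\<^sub>\<infinity>j. exp (2 * lam * (lattice_norm j)\<^sup>2) * (cmod (f j))\<^sup>2)"
  have "cmod (f j) \<le> sqrt S * exp (real CARD('d) / 2 * (ln X)\<^sup>2) / X ^ l1 j" if X: "X \<ge> 1" for X j
  proof -
    have "exp (2 * lam * (lattice_norm j)\<^sup>2) * (cmod (f j))\<^sup>2 \<le> S"
      unfolding S_def using finite_sum_le_infsum[OF s, of "{j}"] by simp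
    moreover have "(exp (lam * (lattice_norm j)\<^sup>2) * cmod (f j))\<^sup>2 = exp (2 * lam * (lattice_norm j)\<^sup>2) * (cmod (f j))\<^sup>2"
      by (simp add: power_mult_distrib exp_double[symmetric] mult.assoc)
    ultimately have "exp (lam * (lattice_norm j)\<^sup>2) * cmod (f j) \<le> sqrt S"
      by (simp add: real_le_rsqrt)
    then have f: "cmod (f j) \<le> sqrt S * exp (- (lam * (lattice_norm j)\<^sup>2))"
      by (simp add: exp_minus field_simps)
    have "ln X * real (l1 j) = (\<Sum>k\<in>UNIV. ln X * \<bar>real_of_int (j $ k)\<bar>)"
      by (simp add: l1_def sum_distrib_left)
    also have "\<dots> \<le> (\<Sum>k\<in>(UNIV :: 'd set). (ln X)\<^sup>2 / 2 + (real_of_int (j $ k))\<^sup>2 / 2)"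
    proof (rule sum_mono)
      fix k show "ln X * \<bar>real_of_int (j $ k)\<bar> \<le> (ln X)\<^sup>2 / 2 + (real_of_int (j $ k))\<^sup>2 / 2"
        using sum_squares_bound[of "ln X" "\<bar>real_of_int (j $ k)\<bar>"] by simp
    qed
    also have "\<dots> = real CARD('d) / 2 * (ln X)\<^sup>2 + (lattice_norm j)\<^sup>2 / 2"
      by (simp add: sum.distrib lattice_norm_power2 sum_divide_distrib)
    also have "\<dots> \<le> real CARD('d) / 2 * (ln X)\<^sup>2 + lam * (lattice_norm j)\<^sup>2"
      using mult_right_mono[of "1 / 2" lam "(lattice_norm j)\<^sup>2"] assms(1) by simp
    finally have "- (lam * (lattice_norm j)\<^sup>2) \<le> real CARD('d) / 2 * (ln X)\<^sup>2 - ln X * real (l1 j)" by simp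
    then have "exp (- (lam * (lattice_norm j)\<^sup>2)) \<le> exp (real CARD('d) / 2 * (ln X)\<^sup>2) / exp (ln X * real (l1 j))"
      by (simp flip: exp_diff)
    also have "exp (ln X * real (l1 j)) = X ^ l1 j"
      using X by (simp add: exp_of_nat2_mult)
    finally have e: "exp (- (lam * (lattice_norm j)\<^sup>2)) \<le> exp (real CARD('d) / 2 * (ln X)\<^sup>2) / X ^ l1 j" .
    have "S \<ge> 0" unfolding S_def by (intro infsum_nonneg) auto
    with f mult_left_mono[OF e, of "sqrt S"] show ?thesis by simp
  qed
  moreover have "sqrt S \<ge> 0" unfolding S_def by (intro real_sqrt_ge_zero infsum_nonneg) auto
  ultimately show thesis using that by blast
qed

section \<open>Unique continuation\<close>

text \<open>A reverse Gronwall inequality for a function known only through its increments: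
  \<open>n\<close> equal steps multiply the value by at least
  \<open>(1 + \<rho> * (b - a) / n) ^ n\<close>, and \<open>n\<close> tends to infinity.
  Nonnegativity is carried along, since \<open>grow\<close> applies only where \<open>F\<close> is
  nonnegative.\<close>

lemma exponential_growth:
  fixes F :: "real \<Rightarrow> real"
  assumes "a \<le> b" "\<rho> \<ge> 0" "F a \<ge> 0"
    and grow: "\<And>x y. a \<le> x \<Longrightarrow> x \<le> y \<Longrightarrow> y \<le> b \<Longrightarrow> F x \<ge> 0 \<Longrightarrow> \<rho> * (y - x) * F x \<le> F y - F x"
  shows "exp (\<rho> * (b - a)) * F a \<le> F b"
proof -
  have step: "(1 + \<rho> * (b - a) / real n) ^ n * F a \<le> F b" if "n > 0" for n
  proof -
    define x where "x k = a + real k * ((b - a) / real n)" for k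
    have "k \<le> n \<Longrightarrow> (1 + \<rho> * (b - a) / real n) ^ k * F a \<le> F (x k)" for k
    proof (induction k)
      case (Suc k)
      have q: "0 \<le> (1 + \<rho> * (b - a) / real n) ^ k * F a" using assms(1-3) by simp
      have Fk: "F (x k) \<ge> 0" using Suc q by simp
      have hh: "a \<le> a + real k * h" "a + real k * h \<le> a + real (Suc k) * h" "a + real (Suc k) * h - (a + real k * h) = h"
        if "h \<ge> 0" for h
        using that by (simp_all add: distrib_right)
      have "(b - a) / real n \<ge> 0" using assms(1) by simp
      from hh[OF this] have le: "a \<le> x k" "x k \<le> x (Suc k)" "x (Suc k) - x k = (b - a) / real n"
        unfolding x_def .
      have "real (Suc k) * ((b - a) / real n) \<le> real n * ((b - a) / real n)"
        using Suc.prems assms(1) by (intro mult_right_mono) auto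
      then have "x (Suc k) \<le> b" using \<open>n > 0\<close> by (simp add: x_def)
      then have "\<rho> * ((b - a) / real n) * F (x k) \<le> F (x (Suc k)) - F (x k)"
        using grow[OF le(1,2) _ Fk] le(3) by simp
      then have "(1 + \<rho> * (b - a) / real n) * F (x k) \<le> F (x (Suc k))"
        by (simp add: algebra_simps)
      moreover have "(1 + \<rho> * (b - a) / real n) * ((1 + \<rho> * (b - a) / real n) ^ k * F a) \<le> (1 + \<rho> * (b - a) / real n) * F (x k)"
        using Suc assms(1,2) by (intro mult_left_mono) auto
      ultimately show ?case by simp
    qed (simp add: x_def)
    from this[of n] show ?thesis using \<open>n > 0\<close> by (simp add: x_def)
  qed
  have "(\<lambda>n. (1 + \<rho> * (b - a) / real n) ^ n * F a) \<longlonglongrightarrow> exp (\<rho> * (b - a)) * F a"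
    by (intro tendsto_intros tendsto_exp_limit_sequentially)
  then show ?thesis
    by (rule LIMSEQ_le_const2) (use step in \<open>auto intro!: exI[of _ 1]\<close>)
qed

section \<open>The weighted current as a function of time\<close>

lemma absolutely_continuous_on_cnj:
  "absolutely_continuous_on S f \<Longrightarrow> absolutely_continuous_on S (\<lambda>t. cnj (f t))"
  unfolding absolutely_continuous_on_def complex_cnj_diff[symmetric] complex_mod_cnj .

lemma Im_current_derivative:
  "Im (a * cnj (\<i> * (m + p * b)) + \<i> * (l + q * a) * cnj b)
     = Re (l * cnj b - a * cnj m) + Re ((q - cnj p) * (a * cnj b))"
  by (simp add: algebra_simps)

locale weighted_solution = bounded_schroedinger V u M
  for V u :: "real \<Rightarrow> int ^ 'd::finite \<Rightarrow> complex" and M +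
  fixes K :: real and k0 :: 'd and T :: "int ^ 'd \<Rightarrow> real"
  assumes K: "K \<ge> 4"
    and T: "T summable_on UNIV"
    and dom: "\<And>t j i a b. t \<in> {0..1} \<Longrightarrow> \<bar>i\<bar> \<le> 2 \<Longrightarrow> l1 a \<le> 2 \<Longrightarrow> l1 b \<le> 2 \<Longrightarrow>
      weight K (j $ k0 + i) * (cmod (u t (j + a)) * cmod (u t (j + b))) \<le> T j"
begin

lemma state: "t \<in> {0..1} \<Longrightarrow> weighted_state K M k0 (u t) (V t) T"
  by unfold_locales (assumption | rule K potential_bound T dom)+

definition flux_at :: "real \<Rightarrow> int ^ 'd \<Rightarrow> real" where
  "flux_at t = weighted_state.flux K k0 (u t)"

definition rate_at :: "real \<Rightarrow> int ^ 'd \<Rightarrow> real" where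
  "rate_at t = weighted_state.rate K k0 (u t) (V t)"

definition F :: "real \<Rightarrow> real" where "F t = infsum (flux_at t) UNIV"

definition \<kappa> :: real where "\<kappa> = K / 2 - 1 - M\<^sup>2"

lemma flux_at_has_integral:
  assumes "0 \<le> a" "a \<le> b" "b \<le> 1"
  shows "((\<lambda>t. rate_at t j) has_integral (flux_at b j - flux_at a j)) {a..b}"
proof -
  define p where "p = j + axis k0 1"
  obtain C where C: "\<And>t j. t \<in> {0..1} \<Longrightarrow> cmod (u t j) \<le> C"
    using that by (rule u_bounded)
  have sub: "{a..b} \<subseteq> {0..1}" using assms by auto
  have ac: "absolutely_continuous_on {a..b} (\<lambda>t. u t i)" for i
    using absolutely_continuous_on_subset[OF component_AC sub] .
  obtain N1 where N1: "negligible N1"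
    "\<And>t. t \<in> {0..1} - N1 \<Longrightarrow> ((\<lambda>s. u s p) has_vector_derivative velocity t p) (at t within {0..1})"
    using component_derivative by blast
  obtain N2 where N2: "negligible N2"
    "\<And>t. t \<in> {0..1} - N2 \<Longrightarrow> ((\<lambda>s. u s j) has_vector_derivative velocity t j) (at t within {0..1})"
    using component_derivative by blast
  have int: "((\<lambda>t. u t p * cnj (velocity t j) + velocity t p * cnj (u t j)) has_integral
      (u b p * cnj (u b j) - u a p * cnj (u a j))) {a..b}"
  proof (rule absolutely_continuous_on_FTC[OF \<open>a \<le> b\<close>])
    show "absolutely_continuous_on {a..b} (\<lambda>t. u t p * cnj (u t j))"
    proof (rule absolutely_continuous_on_mult)
      show "norm (u t p) \<le> C" "norm (cnj (u t j)) \<le> C" if "t \<in> {a..b}" for t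
        using C[of t p] C[of t j] sub that by auto
    qed (intro ac absolutely_continuous_on_cnj)+
    show "negligible (N1 \<union> N2)" using N1(1) N2(1) by (rule negligible_Un)
    fix t assume t: "t \<in> {a..b} - (N1 \<union> N2)"
    then have t1: "t \<in> {0..1} - N1" "t \<in> {0..1} - N2" using sub by auto
    show "((\<lambda>t. u t p * cnj (u t j)) has_vector_derivative
        u t p * cnj (velocity t j) + velocity t p * cnj (u t j)) (at t within {a..b})"
      by (rule has_vector_derivative_mult[OF
          has_vector_derivative_within_subset[OF N1(2)[OF t1(1)] sub]
          bounded_linear.has_vector_derivative[OF bounded_linear_cnj
            has_vector_derivative_within_subset[OF N2(2)[OF t1(2)] sub]]])
  qed
  define c where "c = weighted_state.c K k0 j"
  have ci: "((\<lambda>t. c * Im (u t p * cnj (velocity t j) + velocity t p * cnj (u t j))) has_integral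
      c * Im (u b p * cnj (u b j) - u a p * cnj (u a j))) {a..b}"
    using has_integral_mult_right[OF has_integral_linear[OF int bounded_linear_Im]] by (simp only: o_def)
  have cr: "c * Im (u t p * cnj (velocity t j) + velocity t p * cnj (u t j)) = rate_at t j" if "t \<in> {a..b}" for t
  proof -
    have st: "weighted_state K M k0 (u t) (V t) T" using state sub that by blast
    have "Im (u t p * cnj (velocity t j) + velocity t p * cnj (u t j)) =
      Re (discrete_laplacian (u t) p * cnj (u t j) - u t p * cnj (discrete_laplacian (u t) j))
        + Re ((V t p - cnj (V t j)) * (u t p * cnj (u t j)))"
      unfolding velocity_def by (rule Im_current_derivative)
    then show ?thesis
      unfolding rate_at_def weighted_state.rate_def[OF st] weighted_state.e_def[OF st] c_def p_def by (simp only:)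
  qed
  have fx: "flux_at t j = c * Im (u t p * cnj (u t j))" if "t \<in> {0..1}" for t
    unfolding flux_at_def weighted_state.flux_def[OF state[OF that]] weighted_state.e_def[OF state[OF that]]
      c_def p_def ..
  have cf: "c * Im (u b p * cnj (u b j) - u a p * cnj (u a j)) = flux_at b j - flux_at a j"
    using fx[of a] fx[of b] assms by (simp only: minus_complex.sel right_diff_distrib) simp
  show ?thesis
    using has_integral_eq[OF cr ci] unfolding cf .
qed

lemma rate_at_bound: "t \<in> {0..1} \<Longrightarrow> \<bar>rate_at t j\<bar> \<le> (16 * real CARD('d) + 4 * M) * T j"
  unfolding rate_at_def by (rule weighted_state.rate_bound[OF state])

lemma rate_at_summable: "t \<in> {0..1} \<Longrightarrow> rate_at t summable_on UNIV"
  unfolding rate_at_def by (rule weighted_state.summable(1)[OF state])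

lemma flux_at_summable: "t \<in> {0..1} \<Longrightarrow> flux_at t summable_on UNIV"
  unfolding flux_at_def by (rule weighted_state.summable(2)[OF state])

lemma rate_at_ge_component:
  "t \<in> {0..1} \<Longrightarrow> \<kappa> \<ge> 0 \<Longrightarrow> \<kappa> * (cmod (u t j))\<^sup>2 \<le> infsum (rate_at t) UNIV"
  using weighted_state.total_rate_ge_component[OF state, of t j] weighted_state.\<kappa>_def[OF state, of t]
  by (simp add: rate_at_def \<kappa>_def)

lemma rate_at_ge_F:
  "t \<in> {0..1} \<Longrightarrow> \<kappa> \<ge> 0 \<Longrightarrow> 2 * sqrt \<kappa> * \<bar>F t\<bar> \<le> infsum (rate_at t) UNIV"
  using weighted_state.total_rate_ge_flux[OF state, of t] weighted_state.\<kappa>_def[OF state, of t]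
  by (simp add: rate_at_def flux_at_def F_def \<kappa>_def)

text \<open>Only finite partial sums are integrated in time. Since one family \<open>T\<close>
  serves all times, the discarded tail of the rate is at most \<open>C\<close> times the tail of
  \<open>T\<close>, uniformly in \<open>t\<close>, and disappears when the finite set exhausts the
  lattice.\<close>

lemma F_increment:
  assumes ab: "0 \<le> a" "a \<le> b" "b \<le> 1" and r: "\<And>t. t \<in> {a..b} \<Longrightarrow> r \<le> infsum (rate_at t) UNIV"
  shows "r * (b - a) \<le> F b - F a"
proof -
  define C where "C = 16 * real CARD('d) + 4 * M"
  have sub: "t \<in> {0..1}" if "t \<in> {a..b}" for t using ab that by auto
  have fin: "(r - C * (infsum T UNIV - sum T X)) * (b - a) \<le> sum (flux_at b) X - sum (flux_at a) X"
    if X: "finite X" for X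
  proof -
    have i1: "((\<lambda>t. \<Sum>j\<in>X. rate_at t j) has_integral (\<Sum>j\<in>X. flux_at b j - flux_at a j)) {a..b}"
      by (intro has_integral_sum X flux_at_has_integral ab)
    have i2: "((\<lambda>t. r - C * (infsum T UNIV - sum T X)) has_integral
        (r - C * (infsum T UNIV - sum T X)) * (b - a)) {a..b}"
      using has_integral_const_real[of "r - C * (infsum T UNIV - sum T X)" a b] ab by (simp add: mult.commute)
    have le: "r - C * (infsum T UNIV - sum T X) \<le> (\<Sum>j\<in>X. rate_at t j)" if t: "t \<in> {a..b}" for t
    proof -
      \<comment> \<open>The terms are nonnegative, so a partial sum stays below the total;
        rearranged, this bounds the truncated rate from below.\<close>
      have "((\<lambda>j. C * T j + - rate_at t j) has_sum (C * infsum T UNIV + - infsum (rate_at t) UNIV)) UNIV"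
        using rate_at_summable[OF sub[OF t]] T
        by (intro has_sum_add has_sum_cmult_right) (auto simp: has_sum_uminus)
      moreover have "0 \<le> C * T j + - rate_at t j" for j
        using rate_at_bound[OF sub[OF t], of j] unfolding C_def by linarith
      ultimately have "(\<Sum>j\<in>X. C * T j + - rate_at t j) \<le> C * infsum T UNIV + - infsum (rate_at t) UNIV"
        using X by (intro finite_sum_le_has_sum) auto
      moreover have "(\<Sum>j\<in>X. C * T j + - rate_at t j) = C * sum T X - (\<Sum>j\<in>X. rate_at t j)"
        by (simp add: sum_subtractf sum_distrib_left)
      ultimately show ?thesis using r[OF t] by (simp add: right_diff_distrib)
    qed
    have "(r - C * (infsum T UNIV - sum T X)) * (b - a) \<le> (\<Sum>j\<in>X. flux_at b j - flux_at a j)"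
      by (rule has_integral_le[OF i2 i1]) (rule le)
    then show ?thesis by (simp add: sum_subtractf)
  qed
  have lim: "(sum f \<longlongrightarrow> infsum f UNIV) (finite_subsets_at_top UNIV)" if "f summable_on UNIV" for f :: "int ^ 'd \<Rightarrow> real"
    using infsum_tendsto[OF that] .
  have l1: "((\<lambda>X. (r - C * (infsum T UNIV - sum T X)) * (b - a)) \<longlongrightarrow> (r - C * (infsum T UNIV - infsum T UNIV)) * (b - a)) (finite_subsets_at_top UNIV)"
    by (intro tendsto_intros lim T)
  have l2: "((\<lambda>X. sum (flux_at b) X - sum (flux_at a) X) \<longlongrightarrow> F b - F a) (finite_subsets_at_top UNIV)"
    unfolding F_def using ab by (intro tendsto_intros lim flux_at_summable) auto
  have "(r - C * (infsum T UNIV - infsum T UNIV)) * (b - a) \<le> F b - F a"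
    by (rule tendsto_le[OF _ l2 l1]) (auto intro!: eventually_finite_subsets_at_top_weakI fin)
  then show ?thesis by simp
qed

lemma F_mono:
  assumes "\<kappa> \<ge> 0" "0 \<le> x" "x \<le> y" "y \<le> 1"
  shows "F x \<le> F y"
proof -
  have "0 \<le> infsum (rate_at t) UNIV" if "t \<in> {x..y}" for t
  proof -
    have "0 \<le> 2 * sqrt \<kappa> * \<bar>F t\<bar>" using assms by simp
    also have "\<dots> \<le> infsum (rate_at t) UNIV" using assms that by (intro rate_at_ge_F) auto
    finally show ?thesis .
  qed
  from F_increment[OF assms(2-4) this] show ?thesis by simp
qed

text \<open>A positive value of \<open>F\<close> must grow exponentially until time 1, a negative
  one must grow in modulus backwards until time 0. As \<open>F\<close> is at most \<open>R\<close>
  in modulus at both ends, each one-sided bound is exponentially small in the distance to the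
  respective end.\<close>

lemma F_interior_decay:
  assumes \<kappa>: "\<kappa> \<ge> 0" and x: "x \<in> {0..1}" and R: "\<bar>F 0\<bar> \<le> R" "\<bar>F 1\<bar> \<le> R"
  shows "F x \<le> R * exp (- (2 * sqrt \<kappa> * (1 - x)))" and "- F x \<le> R * exp (- (2 * sqrt \<kappa> * x))"
proof -
  define \<rho> where "\<rho> = 2 * sqrt \<kappa>"
  have \<rho>: "\<rho> \<ge> 0" using \<kappa> by (simp add: \<rho>_def)
  have R0: "R \<ge> 0" using R by linarith
  have solve: "G \<le> R * exp (- s)" if "exp s * G \<le> R'" "R' \<le> R" for G R' s
    using that by (simp add: exp_minus field_simps)
  show "F x \<le> R * exp (- (2 * sqrt \<kappa> * (1 - x)))"
  proof (cases "F x \<ge> 0")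
    case True
    have "exp (\<rho> * (1 - x)) * F x \<le> F 1"
    proof (rule exponential_growth[where F = F, OF _ \<rho>])
      fix y z assume yz: "x \<le> y" "y \<le> z" "z \<le> 1" "F y \<ge> 0"
      have "\<rho> * F y * (z - y) \<le> F z - F y"
      proof (rule F_increment)
        fix t assume t: "t \<in> {y..z}"
        have "F y \<le> F t" using t yz x by (intro F_mono \<kappa>) auto
        then have "\<rho> * F y \<le> \<rho> * \<bar>F t\<bar>" using \<rho> by (intro mult_left_mono) auto
        also have "\<dots> \<le> infsum (rate_at t) UNIV"
          unfolding \<rho>_def using t yz x by (intro rate_at_ge_F \<kappa>) auto
        finally show "\<rho> * F y \<le> infsum (rate_at t) UNIV" .
      qed (use yz x in auto)
      then show "\<rho> * (z - y) * F y \<le> F z - F y" by (simp only: mult_ac)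
    qed (use x True in auto)
    then show ?thesis using solve R by (simp add: \<rho>_def)
  next
    case False
    moreover have "R * exp (- (2 * sqrt \<kappa> * (1 - x))) \<ge> 0" using R0 by simp
    ultimately show ?thesis by linarith
  qed
  show "- F x \<le> R * exp (- (2 * sqrt \<kappa> * x))"
  proof (cases "- F x \<ge> 0")
    case True
    \<comment> \<open>Time reversal: \<open>- F (- s)\<close> on the interval from
      \<open>- x\<close> to 0 satisfies the same growth condition.\<close>
    have "exp (\<rho> * (0 - (- x))) * (- F (- (- x))) \<le> - F (- 0)"
    proof (rule exponential_growth[where F = "\<lambda>s. - F (- s)", OF _ \<rho>])
      fix y z assume yz: "- x \<le> y" "y \<le> z" "z \<le> 0" "- F (- y) \<ge> 0"
      have "\<rho> * (- F (- y)) * (- y - (- z)) \<le> F (- y) - F (- z)"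
      proof (rule F_increment)
        fix t assume t: "t \<in> {- z..- y}"
        have "F t \<le> F (- y)" using t yz x by (intro F_mono \<kappa>) auto
        then have "\<rho> * (- F (- y)) \<le> \<rho> * \<bar>F t\<bar>" using \<rho> by (intro mult_left_mono) auto
        also have "\<dots> \<le> infsum (rate_at t) UNIV"
          unfolding \<rho>_def using t yz x by (intro rate_at_ge_F \<kappa>) auto
        finally show "\<rho> * (- F (- y)) \<le> infsum (rate_at t) UNIV" .
      qed (use yz x in auto)
      then show "\<rho> * (z - y) * (- F (- y)) \<le> - F (- z) - (- F (- y))" by (simp add: algebra_simps)
    qed (use x True in auto)
    then have "exp (\<rho> * x) * (- F x) \<le> - F 0" by simp
    then show ?thesis using solve[of "\<rho> * x" "- F x" "- F 0"] R by (simp add: \<rho>_def)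
  next
    case False
    moreover have "R * exp (- (2 * sqrt \<kappa> * x)) \<ge> 0" using R0 by simp
    ultimately show ?thesis by linarith
  qed
qed

theorem interior_bound:
  assumes \<kappa>: "\<kappa> \<ge> 0" and R: "\<bar>F 0\<bar> \<le> R" "\<bar>F 1\<bar> \<le> R"
    and ab: "0 \<le> a" "a \<le> b" "b \<le> 1" and \<delta>: "\<And>t. t \<in> {a..b} \<Longrightarrow> \<delta> \<le> (cmod (u t j))\<^sup>2"
  shows "\<kappa> * \<delta> * (b - a) \<le> R * (exp (- (2 * sqrt \<kappa> * a)) + exp (- (2 * sqrt \<kappa> * (1 - b))))"
proof -
  have "\<kappa> * \<delta> * (b - a) \<le> F b - F a"
  proof (rule F_increment[OF ab])
    fix t assume t: "t \<in> {a..b}"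
    have "\<kappa> * \<delta> \<le> \<kappa> * (cmod (u t j))\<^sup>2" using \<kappa> \<delta>[OF t] by (rule mult_left_mono[rotated])
    also have "\<dots> \<le> infsum (rate_at t) UNIV"
      using t ab by (intro rate_at_ge_component \<kappa>) auto
    finally show "\<kappa> * \<delta> \<le> infsum (rate_at t) UNIV" .
  qed
  also have "\<dots> \<le> R * (exp (- (2 * sqrt \<kappa> * a)) + exp (- (2 * sqrt \<kappa> * (1 - b))))"
    using F_interior_decay(1)[OF \<kappa> _ R, of b] F_interior_decay(2)[OF \<kappa> _ R, of a] ab
    by (simp add: distrib_left)
  finally show ?thesis .
qed

end

section \<open>Comparison of endpoint size and interior decay as \<open>K\<close> grows\<close>

lemma (in bounded_schroedinger) interior_decay:
  assumes A: "A \<ge> 0" and u0: "\<And>X j. X \<ge> 1 \<Longrightarrow> cmod (u 0 j) \<le> A * exp (real CARD('d) / 2 * (ln X)\<^sup>2) / X ^ l1 j"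
    and X: "X \<ge> 1" and t: "t \<in> {0..1}"
  shows "cmod (u t j) \<le> A * exp ((5 * real CARD('d) + M) * X) / X ^ l1 j"
proof -
  let ?d = "real CARD('d)"
  have "1 + ln X + (ln X)\<^sup>2 / 2 \<le> exp (ln X)" using X by (intro exp_lower_Taylor_quadratic) auto
  moreover have "ln X \<ge> 0" "exp (ln X) = X" using X by simp_all
  ultimately have "(ln X)\<^sup>2 / 2 \<le> X" by linarith
  then have 1: "?d * ((ln X)\<^sup>2 / 2) \<le> ?d * X" by (intro mult_left_mono) auto
  define s where "s = 2 * ?d * X + 2 * ?d + M"
  have 2: "s * t \<le> s * 1"
    unfolding s_def using t X M_nonneg by (intro mult_left_mono add_nonneg_nonneg mult_nonneg_nonneg) auto
  have 3: "?d * 1 \<le> ?d * X" "M * 1 \<le> M * X" using X M_nonneg by (intro mult_left_mono; simp)+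
  have "(5 * ?d + M) * X = 5 * (?d * X) + M * X" "?d / 2 * (ln X)\<^sup>2 = ?d * ((ln X)\<^sup>2 / 2)"
    "s = 2 * (?d * X) + 2 * ?d + M" by (simp_all add: s_def algebra_simps)
  \<comment> \<open>The constant is 5 = 1 + 2 + 2: one from \<open>(ln X)^2 / 2 <= X\<close>, two
    from the neighbours, and two from the diagonal of the Laplacian, where \<open>X >= 1\<close> is
    used.\<close>
  with 1 2 3 have ex: "?d / 2 * (ln X)\<^sup>2 + s * t \<le> (5 * ?d + M) * X"
    by linarith
  have "cmod (u t j) \<le> A * exp (?d / 2 * (ln X)\<^sup>2) * exp ((2 * ?d * X + 2 * ?d + M) * t) / X ^ l1 j"
    using A u0[OF X] by (intro decay_propagation[OF X _ _ t]) auto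
  also have "\<dots> = A * exp (?d / 2 * (ln X)\<^sup>2 + (2 * ?d * X + 2 * ?d + M) * t) / X ^ l1 j"
    by (simp add: exp_add)
  also have "\<dots> \<le> A * exp ((5 * ?d + M) * X) / X ^ l1 j"
    using A X ex unfolding s_def by (intro divide_right_mono mult_left_mono) auto
  finally show ?thesis .
qed

lemma (in weighted_state) total_flux_bound:
  "\<bar>infsum flux UNIV\<bar> \<le> 2 * infsum T UNIV"
proof -
  have T2: "(\<lambda>j. 2 * T j) summable_on UNIV" using T by (rule summable_on_cmult_right)
  have "infsum flux UNIV \<le> (\<Sum>\<^sub>\<infinity>j. 2 * T j)"
    by (rule infsum_mono[OF summable(2) T2]) (use flux_bound in \<open>auto intro: order_trans[OF abs_ge_self]\<close>)
  moreover have "(\<Sum>\<^sub>\<infinity>j. - flux j) \<le> (\<Sum>\<^sub>\<infinity>j. 2 * T j)"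
    by (rule infsum_mono[OF _ T2])
       (use summable(2) flux_bound in \<open>auto simp: summable_on_uminus intro: order_trans[OF abs_ge_minus_self]\<close>)
  ultimately show ?thesis by (simp add: infsum_uminus infsum_cmult_right')
qed

theorem (in bounded_schroedinger) interior_vanishing:
  assumes A: "A \<ge> 0"
    and u0: "\<And>X j. X \<ge> 1 \<Longrightarrow> cmod (u 0 j) \<le> A * exp (real CARD('d) / 2 * (ln X)\<^sup>2) / X ^ l1 j"
    and u1: "\<And>X j. X \<ge> 1 \<Longrightarrow> cmod (u 1 j) \<le> A * exp (real CARD('d) / 2 * (ln X)\<^sup>2) / X ^ l1 j"
    and ab: "0 < a" "a < b" "b < 1" and \<delta>: "\<And>t. t \<in> {a..b} \<Longrightarrow> \<delta> \<le> (cmod (u t j))\<^sup>2"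
  shows "\<delta> \<le> 0"
proof (rule ccontr)
  assume "\<not> \<delta> \<le> 0"
  then have \<delta>0: "\<delta> > 0" by simp
  \<comment> \<open>Any direction will do; \<open>undefined\<close> is some element of the nonempty
    index type.\<close>
  define k0 :: 'd where "k0 = undefined"
  define c where "c = real CARD('d) / 2"
  define G where "G = (\<Sum>\<^sub>\<infinity>j::int ^ 'd. (1 / 2 :: real) ^ l1 j)"
  have c: "c > 0" by (simp add: c_def)
  obtain B where B: "B \<ge> 0"
    "\<And>K (n::nat). K \<ge> 1 \<Longrightarrow> 1024 * K ^ 4 * (A * exp (c * (ln (4 * sqrt (K * (real n + 1))))\<^sup>2))\<^sup>2 * (real n + 2) ^ 4 / 4 ^ n
      \<le> B * K ^ 4 * exp (c * (ln (16 * K))\<^sup>2)"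
    using gaussian_radius_bound[of c A] c by (metis less_imp_le)
  define R where "R K = 2 * (B * K ^ 4 * exp (c * (ln (16 * K))\<^sup>2) * G)" for K
  define \<kappa> where "\<kappa> K = K / 2 - 1 - M\<^sup>2" for K
  have main: "\<kappa> K * \<delta> * (b - a) \<le> R K * (exp (- (2 * sqrt (\<kappa> K) * a)) + exp (- (2 * sqrt (\<kappa> K) * (1 - b))))"
    if K: "K \<ge> 4" "\<kappa> K \<ge> 0" for K
  proof -
    have K1: "K \<ge> 1" "K > 0" using K by auto
    have "5 * real CARD('d) + M \<ge> 0" using M_nonneg by simp
    \<comment> \<open>\<open>D\<close> depends on \<open>K\<close> and serves only to make the sums
      converge; it does not enter the final inequality.\<close>
    then obtain D where D: "D \<ge> 0" "\<And>n::nat. 1024 * K ^ 4 * (A * exp ((5 * real CARD('d) + M) * (4 * sqrt (K * (real n + 1)))))\<^sup>2 * (real n + 2) ^ 4 / 4 ^ n \<le> D"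
      using exponential_radius_bound[OF K1(2), of _ A] by metis
    interpret S: weighted_solution V u M K k0 "\<lambda>j. D * (1 / 2) ^ l1 j"
    proof unfold_locales
      show "(\<lambda>j::int ^ 'd. D * (1 / 2) ^ l1 j) summable_on UNIV"
        by (intro summable_on_cmult_right geometric_l1_summable)
      show "weight K (j $ k0 + i) * (cmod (u t (j + a)) * cmod (u t (j + b))) \<le> D * (1 / 2) ^ l1 j"
        if "t \<in> {0..1}" "\<bar>i\<bar> \<le> 2" "l1 a \<le> 2" "l1 b \<le> 2" for t j i a b
      proof (rule weighted_product_bound[where Y = "\<lambda>X. A * exp ((5 * real CARD('d) + M) * X)", OF K1(1) _ _ D(2) that(2-4)])
        show "cmod (u t j) \<le> A * exp ((5 * real CARD('d) + M) * X) / X ^ l1 j" if "X \<ge> 1" for X j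
          by (rule interior_decay[OF A u0 that \<open>t \<in> {0..1}\<close>])
      qed (use A in simp)
    qed (rule K(1))
    have FR: "\<bar>S.F t\<bar> \<le> R K"
      if ut: "\<And>X j. X \<ge> 1 \<Longrightarrow> cmod (u t j) \<le> A * exp (c * (ln X)\<^sup>2) / X ^ l1 j" and t: "t \<in> {0..1}" for t
    proof -
      \<comment> \<open>At an endpoint the same state admits a second dominating family, whose
        dependence on \<open>K\<close> is explicit. The value of \<open>F\<close> is the same for
        both, so the bound \<open>R K\<close> carries over.\<close>
      interpret W: weighted_state K M k0 "u t" "V t" "\<lambda>j. B * K ^ 4 * exp (c * (ln (16 * K))\<^sup>2) * (1 / 2) ^ l1 j"
      proof unfold_locales
        show "(\<lambda>j::int ^ 'd. B * K ^ 4 * exp (c * (ln (16 * K))\<^sup>2) * (1 / 2) ^ l1 j) summable_on UNIV"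
          by (intro summable_on_cmult_right geometric_l1_summable)
        show "weight K (j $ k0 + i) * (cmod (u t (j + a)) * cmod (u t (j + b))) \<le> B * K ^ 4 * exp (c * (ln (16 * K))\<^sup>2) * (1 / 2) ^ l1 j"
          if "\<bar>i\<bar> \<le> 2" "l1 a \<le> 2" "l1 b \<le> 2" for j i a b
          by (rule weighted_product_bound[where Y = "\<lambda>X. A * exp (c * (ln X)\<^sup>2)", OF K1(1) ut _ B(2)[OF K1(1)] that])
             (use A in auto)
      qed (use K potential_bound[OF t] in auto)
      have "(\<Sum>\<^sub>\<infinity>j::int ^ 'd. B * K ^ 4 * exp (c * (ln (16 * K))\<^sup>2) * (1 / 2) ^ l1 j) = B * K ^ 4 * exp (c * (ln (16 * K))\<^sup>2) * G"
        unfolding G_def by (rule infsum_cmult_right')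
      then show ?thesis
        using W.total_flux_bound unfolding S.F_def S.flux_at_def R_def by simp
    qed
    have "\<bar>S.F 0\<bar> \<le> R K" "\<bar>S.F 1\<bar> \<le> R K"
      by (rule FR; use u0 u1 in \<open>simp add: c_def\<close>)+
    then show ?thesis
      using S.interior_bound[of "R K" a b \<delta> j] K(2) ab \<delta> by (simp add: S.\<kappa>_def \<kappa>_def)
  qed
  have lim: "((\<lambda>K. R K * (exp (- (2 * sqrt (\<kappa> K) * a)) + exp (- (2 * sqrt (\<kappa> K) * (1 - b))))) \<longlongrightarrow> 0) at_top"
  proof -
    \<comment> \<open>The decisive comparison: \<open>sqrt K\<close> outgrows both
      \<open>(ln K)^2\<close> and the logarithm of the power of \<open>K\<close>.\<close>
    have decay: "((\<lambda>K. K ^ 4 * exp (c * (ln (16 * K))\<^sup>2) * exp (- (2 * sqrt (K / 2 - 1 - m) * s))) \<longlongrightarrow> 0) at_top"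
      if "s > 0" for s m :: real
      using that c by real_asymp
    have "((\<lambda>K. 2 * B * G * (K ^ 4 * exp (c * (ln (16 * K))\<^sup>2) * exp (- (2 * sqrt (K / 2 - 1 - M\<^sup>2) * a)))
        + 2 * B * G * (K ^ 4 * exp (c * (ln (16 * K))\<^sup>2) * exp (- (2 * sqrt (K / 2 - 1 - M\<^sup>2) * (1 - b))))) \<longlongrightarrow> 2 * B * G * 0 + 2 * B * G * 0) at_top"
      by (intro tendsto_intros decay) (use ab in auto)
    then show ?thesis by (simp add: R_def \<kappa>_def algebra_simps)
  qed
  have "\<delta> * (b - a) > 0" using \<delta>0 ab by simp
  then have "eventually (\<lambda>K. R K * (exp (- (2 * sqrt (\<kappa> K) * a)) + exp (- (2 * sqrt (\<kappa> K) * (1 - b)))) < \<delta> * (b - a)) at_top"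
    by (rule order_tendstoD(2)[OF lim])
  \<comment> \<open>The threshold gives \<open>\<kappa> K >= 1\<close>, so the left side of
    \<open>main\<close> stays above the fixed positive number
    \<open>\<delta> * (b - a)\<close>.\<close>
  moreover have "eventually (\<lambda>K. K \<ge> 4 + 2 * M\<^sup>2) at_top" by (rule eventually_ge_at_top)
  ultimately have "eventually (\<lambda>K::real. False) at_top"
  proof eventually_elim
    case (elim K)
    have "K \<ge> 4" "\<kappa> K \<ge> 1" using elim(2) zero_le_power2[of M] unfolding \<kappa>_def by linarith+
    then have "1 * (\<delta> * (b - a)) \<le> \<kappa> K * (\<delta> * (b - a))"
      using \<delta>0 ab by (intro mult_right_mono) auto
    with main[of K] \<open>K \<ge> 4\<close> \<open>\<kappa> K \<ge> 1\<close> elim(1) show False by (simp add: mult.assoc)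
  qed
  then show False by simp
qed

lemma ell2_continuous_on_component:
  assumes "ell2_continuous_on S u"
  shows "continuous_on S (\<lambda>t. u t j)"
  unfolding continuous_on_def
proof
  fix t assume t: "t \<in> S"
  have lim: "((\<lambda>s. ell2_norm (\<lambda>j. u s j - u t j)) \<longlongrightarrow> 0) (at t within S)"
    using assms t by (simp add: ell2_continuous_on_def)
  have "eventually (\<lambda>s. norm (u s j - u t j) \<le> ell2_norm (\<lambda>j. u s j - u t j)) (at t within S)"
    unfolding eventually_at_filter
  proof (intro always_eventually allI impI)
    fix s assume "s \<in> S"
    then have "u s \<in> ell2" "u t \<in> ell2" using assms t by (auto simp: ell2_continuous_on_def)
    then show "norm (u s j - u t j) \<le> ell2_norm (\<lambda>j. u s j - u t j)"
      by (intro cmod_le_ell2_norm[where f = "\<lambda>j. u s j - u t j"] ell2_diff)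
  qed
  from Lim_null_comparison[OF this lim] show "((\<lambda>t. u t j) \<longlongrightarrow> u t j) (at t within S)"
    by (rule Lim_null[THEN iffD2])
qed

theorem theorem4p1:
  fixes V u :: "real \<Rightarrow> int ^ 'd::finite \<Rightarrow> complex" and lam :: real
  assumes "bounded_potential V"
    and "schroedinger_solution V u"
    and "lam > 1 / 2"
    and "(\<lambda>j. exp (2 * lam * (lattice_norm j)\<^sup>2) * (cmod (u 0 j))\<^sup>2) summable_on UNIV"
    and "(\<lambda>j. exp (2 * lam * (lattice_norm j)\<^sup>2) * (cmod (u 1 j))\<^sup>2) summable_on UNIV"
  shows "\<forall>t\<in>{0..1}. \<forall>j. u t j = 0"
proof -
  obtain M where M: "\<And>t j. t \<in> {0..1} \<Longrightarrow> cmod (V t j) \<le> M"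
    using assms(1) unfolding bounded_potential_def bdd_above_def by fastforce
  interpret bounded_schroedinger V u M
    by unfold_locales (use assms(2) M in auto)
  obtain A0 where A0: "A0 \<ge> 0" "\<And>X j. X \<ge> 1 \<Longrightarrow> cmod (u 0 j) \<le> A0 * exp (real CARD('d) / 2 * (ln X)\<^sup>2) / X ^ l1 j"
    using gaussian_decay[OF assms(3,4)] by metis
  obtain A1 where A1: "A1 \<ge> 0" "\<And>X j. X \<ge> 1 \<Longrightarrow> cmod (u 1 j) \<le> A1 * exp (real CARD('d) / 2 * (ln X)\<^sup>2) / X ^ l1 j"
    using gaussian_decay[OF assms(3,5)] by metis
  have mono: "A * exp (real CARD('d) / 2 * (ln X)\<^sup>2) / X ^ l1 j \<le> (A0 + A1) * exp (real CARD('d) / 2 * (ln X)\<^sup>2) / X ^ l1 j"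
    if "A \<le> A0 + A1" "X \<ge> 1" for A X and j :: "int ^ 'd"
    using that by (intro divide_right_mono mult_right_mono) auto
  have u01: "cmod (u 0 j) \<le> (A0 + A1) * exp (real CARD('d) / 2 * (ln X)\<^sup>2) / X ^ l1 j"
    "cmod (u 1 j) \<le> (A0 + A1) * exp (real CARD('d) / 2 * (ln X)\<^sup>2) / X ^ l1 j" if "X \<ge> 1" for X j
    using order_trans[OF A0(2) mono] order_trans[OF A1(2) mono] that A0(1) A1(1) by auto
  have cont: "continuous_on {0..1} (\<lambda>t. u t j)" for j
    using assms(2) by (intro ell2_continuous_on_component) (simp add: schroedinger_solution_def)
  have inner: "u t j = 0" if t: "t \<in> {0<..<1}" for t j
  proof (rule ccontr)
    assume nz: "u t j \<noteq> 0"
    have "continuous_on {0<..<1} (\<lambda>t. cmod (u t j))"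
      by (intro continuous_on_norm continuous_on_subset[OF cont]) auto
    then have "isCont (\<lambda>t. cmod (u t j)) t"
      using t by (simp add: continuous_on_eq_continuous_at)
    then have "eventually (\<lambda>s. cmod (u t j) / 2 < cmod (u s j)) (at t)"
      using nz by (intro order_tendstoD(1)[OF isContD]) auto
    then obtain r where r: "r > 0" "\<And>s. s \<noteq> t \<Longrightarrow> dist s t < r \<Longrightarrow> cmod (u t j) / 2 < cmod (u s j)"
      unfolding eventually_at by blast
    \<comment> \<open>Staying within \<open>r / 2\<close> of \<open>t\<close> keeps \<open>u\<close>
      above half its modulus at \<open>t\<close>, and the midpoint between \<open>t\<close> and 1
      keeps \<open>b\<close> below 1.\<close>
    define b where "b = min (t + r / 2) ((t + 1) / 2)"
    have b: "t < b" "b < 1" "b \<le> t + r / 2" using t r(1) by (auto simp: b_def min_def)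
    have "(cmod (u t j) / 2)\<^sup>2 \<le> 0"
    proof (rule interior_vanishing[OF _ u01])
      show "(cmod (u t j) / 2)\<^sup>2 \<le> (cmod (u s j))\<^sup>2" if s: "s \<in> {t..b}" for s
      proof (rule power_mono)
        show "cmod (u t j) / 2 \<le> cmod (u s j)"
        proof (cases "s = t")
          case False
          have "dist s t < r" using s b r(1) by (simp add: dist_real_def)
          then show ?thesis using r(2)[of s] False by simp
        qed simp
      qed simp
    qed (use t b A0 A1 in auto)
    then show False using nz by simp
  qed
  show ?thesis
  proof (intro ballI allI)
    fix t :: real and j assume t: "t \<in> {0..1}"
    \<comment> \<open>The exponential gain is lost at the times 0 and 1, which are reached by
      continuity instead.\<close>
    have cl: "closure {0<..<1::real} = {0..1}" by (rule closure_greaterThanLessThan) simp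
    show "u t j = 0"
    proof (rule continuous_constant_on_closure[where S = "{0<..<1}" and f = "\<lambda>t. u t j" and x = t])
      show "continuous_on (closure {0<..<1}) (\<lambda>t. u t j)" unfolding cl by (rule cont)
      show "t \<in> closure {0<..<1}" unfolding cl by (rule t)
    qed (rule inner)
  qed
qed

end
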